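(* Let $(M,g)$ be a light-like manifold of nullity degree $1$ such that the line bundle $Rad(TM)$ is trivial, and let $\xi\in\Gamma(Rad(TM))$ be a nowhere vanishing section. Suppose $L_\xi g=0$ and let there exist a closed smooth 1-form $\tau$ on $M$ with $\tau(\xi)=1$. Then there exists a unique torsion-free linear connection $\nabla$ on $M$ with $\nabla_X g=0$ and $\nabla_X\tau=0$ for all $X\in\Gamma(TM)$.
   Context: A light-like manifold $(M,g)$ is a smooth manifold $M$ with a smooth symmetric $(0,2)$-tensor field $g$ of constant index and constant nullity degree (co-rank). $Rad(TM)$ is the radical of $g$: the subbundle of $TM$ with fibres $Rad(T_xM)=\{v\in T_xM : g(v,w)=0 \text{ for all } w\in T_xM\}$; its rank equals the nullity degree. $\Gamma(E)$ denotes the space of smooth sections of a bundle $E$. $L$ denotes the Lie derivative. Conventions: $(\nabla_Xg)(Y,Z)=X(g(Y,Z))-g(\nabla_XY,Z)-g(Y,\nabla_XZ)$, $(\nabla_X\tau)(Y)=X(\tau(Y))-\tau(\nabla_XY)$. *)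

theory Defs
  imports "HOL-Analysis.Analysis" "HOL-Library.Function_Algebras"
begin

text \<open>Pointwise real vector space structure on functions, so that the library's
  \<^const>\<open>subspace\<close> and \<^term>\<open>dim\<close> apply to sets of derivations.\<close>

instantiation "fun" :: (type, real_vector) real_vector
begin

definition scaleR_fun :: "real \<Rightarrow> ('a \<Rightarrow> 'b) \<Rightarrow> 'a \<Rightarrow> 'b"
  where "scaleR_fun r f = (\<lambda>x. r *\<^sub>R f x)"

instance
  by standard (auto simp: scaleR_fun_def plus_fun_def algebra_simps)

end


section \<open>Smooth manifolds\<close>

text \<open>\<open>Ck_on k S f\<close>: \<open>f\<close> is of class $C^k$ on the open set \<open>S\<close>. On a finite-dimensional
  domain this is existence of all directional derivatives of order \<open>k\<close>, iteratively, together
  with their continuity.\<close>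

primrec Ck_on ::
  "nat \<Rightarrow> 'e::euclidean_space set \<Rightarrow> ('e \<Rightarrow> 'f::real_normed_vector) \<Rightarrow> bool"
  where
    "Ck_on 0 S f \<longleftrightarrow> continuous_on S f"
  | "Ck_on (Suc k) S f \<longleftrightarrow>
       (\<forall>x\<in>S. f differentiable (at x)) \<and> (\<forall>v. Ck_on k S (\<lambda>x. frechet_derivative f (at x) v))"

definition smooth_on ::
  "'e::euclidean_space set \<Rightarrow> ('e \<Rightarrow> 'f::real_normed_vector) \<Rightarrow> bool"
  where "smooth_on S f \<longleftrightarrow> (\<forall>k. Ck_on k S f)"

text \<open>A chart is a pair of its domain and its coordinate map (whose values off the domain are
  irrelevant).\<close>

type_synonym ('a, 'e) chart = "'a set \<times> ('a \<Rightarrow> 'e)"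

definition is_chart :: "('a::topological_space, 'e::euclidean_space) chart \<Rightarrow> bool"
  where "is_chart = (\<lambda>(U, \<phi>). open U \<and> open (\<phi> ` U) \<and>
           homeomorphism U (\<phi> ` U) \<phi> (inv_into U \<phi>))"

text \<open>The manifold is the whole type \<open>'a\<close>, of dimension \<open>DIM('e)\<close>, with smooth structure given
  by an atlas that need not be maximal.\<close>

definition smooth_atlas ::
  "('a::{t2_space,second_countable_topology}, 'e::euclidean_space) chart set \<Rightarrow> bool"
  where "smooth_atlas A \<longleftrightarrow>
    (\<forall>c\<in>A. is_chart c) \<and>
    (\<Union>(U, \<phi>)\<in>A. U) = UNIV \<and>
    (\<forall>(U, \<phi>)\<in>A. \<forall>(V, \<psi>)\<in>A. smooth_on (\<phi> ` (U \<inter> V)) (\<psi> \<circ> inv_into U \<phi>))"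

definition smooth_functions :: "('a, 'e::euclidean_space) chart set \<Rightarrow> ('a \<Rightarrow> real) set"
  where "smooth_functions A = {f. \<forall>(U, \<phi>)\<in>A. smooth_on (\<phi> ` U) (f \<circ> inv_into U \<phi>)}"


section \<open>Tangent vectors and vector fields\<close>

type_synonym 'a tangent_vector = "('a \<Rightarrow> real) \<Rightarrow> real"
type_synonym 'a field = "'a \<Rightarrow> 'a tangent_vector"

text \<open>Tangent vectors at \<open>p\<close> are the derivations at \<open>p\<close> of the algebra of smooth functions.
  They are given the value 0 on non-smooth functions, so that equality of tangent vectors is
  equality of derivations.\<close>

definition tangent_space ::
  "('a, 'e::euclidean_space) chart set \<Rightarrow> 'a \<Rightarrow> 'a tangent_vector set"
  where "tangent_space A p = {v.
    (\<forall>f\<in>smooth_functions A. \<forall>h\<in>smooth_functions A.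
        v (\<lambda>x. f x + h x) = v f + v h \<and>
        v (\<lambda>x. f x * h x) = f p * v h + h p * v f) \<and>
    (\<forall>c. \<forall>f\<in>smooth_functions A. v (\<lambda>x. c * f x) = c * v f) \<and>
    (\<forall>f. f \<notin> smooth_functions A \<longrightarrow> v f = 0)}"

text \<open>Smooth sections of a subbundle \<open>E\<close> of the tangent bundle: a field \<open>X\<close> is smooth iff it maps
  smooth functions to smooth functions.\<close>

definition smooth_sections ::
  "('a, 'e::euclidean_space) chart set \<Rightarrow> ('a \<Rightarrow> 'a tangent_vector set) \<Rightarrow> 'a field set"
  where "smooth_sections A E = {X. (\<forall>p. X p \<in> E p) \<and>
    (\<forall>f\<in>smooth_functions A. (\<lambda>p. X p f) \<in> smooth_functions A)}"

abbreviation vector_fields :: "('a, 'e::euclidean_space) chart set \<Rightarrow> 'a field set"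
  where "vector_fields A \<equiv> smooth_sections A (tangent_space A)"

definition fun_scale :: "('a \<Rightarrow> real) \<Rightarrow> 'a field \<Rightarrow> 'a field"
  where "fun_scale f X = (\<lambda>p. f p *\<^sub>R X p)"

definition lie_bracket :: "'a field \<Rightarrow> 'a field \<Rightarrow> 'a field"
  where "lie_bracket X Y = (\<lambda>p f. X p (\<lambda>q. Y q f) - Y p (\<lambda>q. X q f))"

definition linear_form_on :: "'v::real_vector set \<Rightarrow> ('v \<Rightarrow> real) \<Rightarrow> bool"
  where "linear_form_on T L \<longleftrightarrow>
    (\<forall>v\<in>T. \<forall>w\<in>T. L (v + w) = L v + L w) \<and> (\<forall>c. \<forall>v\<in>T. L (c *\<^sub>R v) = c * L v)"

text \<open>Triviality of a line bundle: a fibrewise linear bijection onto the product bundle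
  \<open>M \<times> \<real>\<close> that is smooth in both directions, i.e. carries smooth sections to smooth sections.\<close>

definition trivial_line_bundle ::
  "('a, 'e::euclidean_space) chart set \<Rightarrow> ('a \<Rightarrow> 'a tangent_vector set) \<Rightarrow> bool"
  where "trivial_line_bundle A E \<longleftrightarrow> (\<exists>\<Phi>.
    (\<forall>p. linear_form_on (E p) (\<Phi> p) \<and> bij_betw (\<Phi> p) (E p) UNIV) \<and>
    (\<forall>X\<in>smooth_sections A E. (\<lambda>p. \<Phi> p (X p)) \<in> smooth_functions A) \<and>
    (\<forall>f\<in>smooth_functions A. (\<lambda>p. inv_into (E p) (\<Phi> p) (f p)) \<in> smooth_sections A E))"


section \<open>One-forms and light-like metrics\<close>

type_synonym 'a form = "'a \<Rightarrow> 'a tangent_vector \<Rightarrow> real"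
type_synonym 'a bilinear_field = "'a \<Rightarrow> 'a tangent_vector \<Rightarrow> 'a tangent_vector \<Rightarrow> real"

text \<open>The values of forms and of \<open>(0,2)\<close>-tensors matter only on the tangent spaces. Smoothness means
  that evaluation on smooth vector fields gives smooth functions.\<close>

definition smooth_one_form :: "('a, 'e::euclidean_space) chart set \<Rightarrow> 'a form \<Rightarrow> bool"
  where "smooth_one_form A \<tau> \<longleftrightarrow>
    (\<forall>p. linear_form_on (tangent_space A p) (\<tau> p)) \<and>
    (\<forall>X\<in>vector_fields A. (\<lambda>p. \<tau> p (X p)) \<in> smooth_functions A)"

definition closed_one_form :: "('a, 'e::euclidean_space) chart set \<Rightarrow> 'a form \<Rightarrow> bool"
  where "closed_one_form A \<tau> \<longleftrightarrow> smooth_one_form A \<tau> \<and>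
    (\<forall>X\<in>vector_fields A. \<forall>Y\<in>vector_fields A. \<forall>p.
       X p (\<lambda>q. \<tau> q (Y q)) - Y p (\<lambda>q. \<tau> q (X q)) - \<tau> p (lie_bracket X Y p) = 0)"

definition smooth_symmetric_tensor ::
  "('a, 'e::euclidean_space) chart set \<Rightarrow> 'a bilinear_field \<Rightarrow> bool"
  where "smooth_symmetric_tensor A g \<longleftrightarrow>
    (\<forall>p. \<forall>v\<in>tangent_space A p.
        linear_form_on (tangent_space A p) (g p v) \<and>
        (\<forall>w\<in>tangent_space A p. g p v w = g p w v)) \<and>
    (\<forall>X\<in>vector_fields A. \<forall>Y\<in>vector_fields A. (\<lambda>p. g p (X p) (Y p)) \<in> smooth_functions A)"

definition radical_space ::
  "('a, 'e::euclidean_space) chart set \<Rightarrow> 'a bilinear_field \<Rightarrow> 'a \<Rightarrow> 'a tangent_vector set"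
  where "radical_space A g p = {v \<in> tangent_space A p. \<forall>w\<in>tangent_space A p. g p v w = 0}"

text \<open>The index of \<open>g\<close> at \<open>p\<close> is the largest dimension of a subspace of the tangent space on which
  \<open>g\<close> is negative definite.\<close>

definition index_at ::
  "('a, 'e::euclidean_space) chart set \<Rightarrow> 'a bilinear_field \<Rightarrow> 'a \<Rightarrow> nat"
  where "index_at A g p = Max {dim W | W.
    subspace W \<and> W \<subseteq> tangent_space A p \<and> (\<forall>v\<in>W. v \<noteq> 0 \<longrightarrow> g p v v < 0)}"

text \<open>Light-like metric of nullity degree \<open>r\<close>.\<close>

definition light_like_metric ::
  "('a, 'e::euclidean_space) chart set \<Rightarrow> nat \<Rightarrow> 'a bilinear_field \<Rightarrow> bool"
  where "light_like_metric A r g \<longleftrightarrow>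
    smooth_symmetric_tensor A g \<and>
    (\<exists>\<nu>. \<forall>p. index_at A g p = \<nu>) \<and>
    (\<forall>p. dim (radical_space A g p) = r)"

definition lie_derivative ::
  "'a field \<Rightarrow> 'a bilinear_field \<Rightarrow> 'a field \<Rightarrow> 'a field \<Rightarrow> 'a \<Rightarrow> real"
  where "lie_derivative X g Y Z p =
    X p (\<lambda>q. g q (Y q) (Z q)) - g p (lie_bracket X Y p) (Z p) - g p (Y p) (lie_bracket X Z p)"


section \<open>Linear connections\<close>

type_synonym 'a connection = "'a field \<Rightarrow> 'a field \<Rightarrow> 'a field"

text \<open>A connection is a map \<open>\<Gamma>(TM) \<times> \<Gamma>(TM) \<rightarrow> \<Gamma>(TM)\<close>; the extensional function space makes equality
  of connections equality of such maps.\<close>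

definition linear_connection ::
  "('a, 'e::euclidean_space) chart set \<Rightarrow> 'a connection \<Rightarrow> bool"
  where "linear_connection A D \<longleftrightarrow>
    D \<in> vector_fields A \<rightarrow>\<^sub>E (vector_fields A \<rightarrow>\<^sub>E vector_fields A) \<and>
    (\<forall>X\<in>vector_fields A. \<forall>X'\<in>vector_fields A. \<forall>Y\<in>vector_fields A.
       D (X + X') Y = D X Y + D X' Y) \<and>
    (\<forall>f\<in>smooth_functions A. \<forall>X\<in>vector_fields A. \<forall>Y\<in>vector_fields A.
       D (fun_scale f X) Y = fun_scale f (D X Y)) \<and>
    (\<forall>X\<in>vector_fields A. \<forall>Y\<in>vector_fields A. \<forall>Y'\<in>vector_fields A.
       D X (Y + Y') = D X Y + D X Y') \<and>
    (\<forall>c. \<forall>X\<in>vector_fields A. \<forall>Y\<in>vector_fields A. D X (c *\<^sub>R Y) = c *\<^sub>R D X Y) \<and>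
    (\<forall>f\<in>smooth_functions A. \<forall>X\<in>vector_fields A. \<forall>Y\<in>vector_fields A.
       D X (fun_scale f Y) = fun_scale (\<lambda>p. X p f) Y + fun_scale f (D X Y))"

definition torsion_free :: "('a, 'e::euclidean_space) chart set \<Rightarrow> 'a connection \<Rightarrow> bool"
  where "torsion_free A D \<longleftrightarrow>
    (\<forall>X\<in>vector_fields A. \<forall>Y\<in>vector_fields A. D X Y - D Y X - lie_bracket X Y = 0)"

definition cov_deriv_metric ::
  "'a connection \<Rightarrow> 'a bilinear_field \<Rightarrow> 'a field \<Rightarrow> 'a field \<Rightarrow> 'a field \<Rightarrow> 'a \<Rightarrow> real"
  where "cov_deriv_metric D g X Y Z p =
    X p (\<lambda>q. g q (Y q) (Z q)) - g p (D X Y p) (Z p) - g p (Y p) (D X Z p)"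

definition cov_deriv_form ::
  "'a connection \<Rightarrow> 'a form \<Rightarrow> 'a field \<Rightarrow> 'a field \<Rightarrow> 'a \<Rightarrow> real"
  where "cov_deriv_form D \<tau> X Y p = X p (\<lambda>q. \<tau> q (Y q)) - \<tau> p (D X Y p)"

end

theory Submission
  imports Defs
begin

text \<open>The theorem is the fundamental theorem of semi-Riemannian geometry with the nondegeneracy of the metric
  replaced by the pair \<open>(g, \<tau>)\<close>. Because the radical of \<open>g\<close> is spanned by \<open>\<xi>\<close> and \<open>\<tau> \<xi> = 1\<close>, a tangent
  vector \<open>u\<close> is determined by the form \<open>g u\<close> and the number \<open>\<tau> u\<close> (lemma \<open>nondegenerate\<close>). For a
  torsion-free connection compatible with both, the usual computation gives the Koszul formula
  \<open>g (\<nabla>\<^sub>X Y) Z = koszul X Y Z\<close>, and compatibility with \<open>\<tau>\<close> gives \<open>\<tau> (\<nabla>\<^sub>X Y) = X (\<tau> Y)\<close>. This is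
  uniqueness.

  For existence these two equations have to be solved for \<open>\<nabla>\<^sub>X Y\<close>. The first one forces
  \<open>koszul X Y \<xi> = 0\<close>; that is the assumption \<open>L\<^sub>\<xi> g = 0\<close> (lemma \<open>koszul_xi\<close>). Given this, the two
  equations are equivalent to one equation for the nondegenerate form \<open>g + \<tau> \<otimes> \<tau>\<close>. It is solvable at
  each point, and its solution depends smoothly on the point (lemma \<open>local_solution\<close>). The rules for a
  connection, the compatibility with \<open>g\<close> and half of the torsion-freeness are then identities of the
  Koszul expression; the other half, \<open>\<tau>\<close> applied to the torsion, is the closedness of \<open>\<tau>\<close>.

  Solving pointwise and smoothly requires local frames. As tangent vectors are derivations of the
  algebra of globally defined smooth functions, this rests on bump functions, by which derivations
  become local (\<open>tangent_local\<close>), and on Hadamard's lemma, by which a derivation is determined by its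
  values on coordinates (\<open>local_frame\<close>). Smooth dependence is Cramer's rule
  (\<open>smooth_linear_system\<close>).\<close>

section \<open>Maps of class $C^k$ on open sets\<close>

lemma Ck_on_cong_imp:
  assumes "open S" "\<And>x. x \<in> S \<Longrightarrow> f x = g x" "Ck_on k S f"
  shows "Ck_on k S g"
  using assms(2,3)
proof (induction k arbitrary: f g)
  case 0
  then show ?case by (metis Ck_on.simps(1) continuous_on_cong)
next
  case (Suc k)
  have d: "(g has_derivative frechet_derivative f (at x)) (at x)" if "x \<in> S" for x
    using Suc.prems that assms(1) has_derivative_transform_within_open[of f _ x UNIV S g]
    by (auto simp: frechet_derivative_works)
  then have e: "frechet_derivative f (at x) = frechet_derivative g (at x)" if "x \<in> S" for x
    using that frechet_derivative_at by blast
  have "Ck_on k S (\<lambda>x. frechet_derivative g (at x) v)" for v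
    using Suc.IH[of "\<lambda>x. frechet_derivative f (at x) v"] Suc.prems e by simp
  with d show ?case by (auto simp: differentiable_def)
qed

lemma Ck_on_subset: "Ck_on k S f \<Longrightarrow> T \<subseteq> S \<Longrightarrow> Ck_on k T f"
  by (induction k arbitrary: f) (auto intro: continuous_on_subset)

lemma Ck_on_local:
  assumes "\<And>x. x \<in> S \<Longrightarrow> \<exists>T. open T \<and> x \<in> T \<and> Ck_on k T f"
  shows "Ck_on k S f"
  using assms
proof (induction k arbitrary: f)
  case 0
  have "isCont f x" if "x \<in> S" for x
    using 0[OF that] by (auto simp: continuous_on_eq_continuous_at)
  then show ?case by (simp add: continuous_at_imp_continuous_on)
next
  case (Suc k)
  have "Ck_on k S (\<lambda>x. frechet_derivative f (at x) v)" for v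
    by (rule Suc.IH) (use Suc.prems in fastforce)
  then show ?case using Suc.prems by fastforce
qed

text \<open>The recursion of \<open>Ck_on\<close> speaks of the chosen derivative
  \<open>frechet_derivative\<close>; with an explicit derivative at hand, this rule avoids identifying the two
  each time.\<close>

lemma Ck_on_SucI:
  assumes "open S" "\<And>x. x \<in> S \<Longrightarrow> (f has_derivative f' x) (at x)"
    "\<And>v. Ck_on k S (\<lambda>x. f' x v)"
  shows "Ck_on (Suc k) S f"
proof -
  have e: "f' x = frechet_derivative f (at x)" if "x \<in> S" for x
    using frechet_derivative_at[OF assms(2)[OF that]] .
  have "Ck_on k S (\<lambda>x. frechet_derivative f (at x) v)" for v
    by (rule Ck_on_cong_imp[OF assms(1) _ assms(3)[of v]]) (simp add: e)
  then show ?thesis using assms(2) by (auto simp: differentiable_def)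
qed

lemma Ck_on_SucD:
  assumes "Ck_on (Suc k) S f"
  shows "\<And>x. x \<in> S \<Longrightarrow> (f has_derivative frechet_derivative f (at x)) (at x)"
    and "Ck_on k S (\<lambda>x. frechet_derivative f (at x) v)"
  using assms by (auto simp: frechet_derivative_works[symmetric])

lemma Ck_on_Suc_imp: "Ck_on (Suc k) S f \<Longrightarrow> Ck_on k S f"
proof (induction k arbitrary: f)
  case 0
  then show ?case
    by (auto intro!: continuous_at_imp_continuous_on differentiable_imp_continuous_within)
next
  case (Suc k)
  have "Ck_on k S (\<lambda>x. frechet_derivative f (at x) v)" for v
    by (rule Suc.IH[OF Ck_on_SucD(2)[OF Suc.prems]])
  moreover have "\<forall>x\<in>S. f differentiable (at x)"
    using Suc.prems by simp
  ultimately show ?case by simp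
qed

lemma Ck_on_const: "Ck_on k S (\<lambda>x. c)"
  by (induction k arbitrary: c) auto

lemma Ck_on_bounded_linear:
  assumes "bounded_linear L"
  shows "Ck_on k S L"
proof (rule Ck_on_subset)
  show "Ck_on k UNIV L"
  proof (cases k)
    case 0
    then show ?thesis using assms by (simp add: linear_continuous_on)
  next
    case (Suc j)
    show ?thesis unfolding Suc
      by (rule Ck_on_SucI[where f' = "\<lambda>x. L"])
        (auto simp: Ck_on_const intro: bounded_linear_imp_has_derivative assms)
  qed
qed simp

lemma Ck_on_add:
  assumes "open S" "Ck_on k S f" "Ck_on k S g"
  shows "Ck_on k S (\<lambda>x. f x + g x)"
  using assms(2,3)
proof (induction k arbitrary: f g)
  case 0
  then show ?case by (simp add: continuous_on_add)
next
  case (Suc k)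
  show ?case
    by (rule Ck_on_SucI[OF assms(1) has_derivative_add])
      (use Suc Ck_on_SucD in blast)+
qed

lemma (in bounded_bilinear) Ck_on_prod:
  assumes "open S" "Ck_on k S f" "Ck_on k S g"
  shows "Ck_on k S (\<lambda>x. prod (f x) (g x))"
  using assms(2,3)
proof (induction k arbitrary: f g)
  case 0
  then show ?case by (simp add: continuous_on)
next
  case (Suc k)
  show ?case
  proof (rule Ck_on_SucI[OF assms(1)
        FDERIV[OF Ck_on_SucD(1)[OF Suc.prems(1)] Ck_on_SucD(1)[OF Suc.prems(2)]]])
    fix v
    show "Ck_on k S (\<lambda>x. prod (f x) (frechet_derivative g (at x) v)
        + prod (frechet_derivative f (at x) v) (g x))"
      using Suc.prems by (intro Ck_on_add assms(1) Suc.IH Ck_on_SucD(2)) (auto intro: Ck_on_Suc_imp)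
  qed
qed

lemmas Ck_on_scaleR = bounded_bilinear.Ck_on_prod[OF bounded_bilinear_scaleR]
lemmas Ck_on_mult = bounded_bilinear.Ck_on_prod[OF bounded_bilinear_mult]
lemmas Ck_on_inner = bounded_bilinear.Ck_on_prod[OF bounded_bilinear_inner]

lemma Ck_on_sum:
  assumes "open S" "\<And>i. i \<in> I \<Longrightarrow> Ck_on k S (f i)"
  shows "Ck_on k S (\<lambda>x. \<Sum>i\<in>I. f i x)"
  using assms(2)
proof (induction I rule: infinite_finite_induct)
  case (insert i I)
  then show ?case by (simp add: Ck_on_add[OF assms(1)])
qed (auto simp: Ck_on_const)

text \<open>By the chain rule the derivative of \<open>g \<circ> f\<close> is that of \<open>g\<close>, taken at \<open>f x\<close>, in a direction
  that itself varies with \<open>x\<close>. Expanding this direction in the standard basis leaves only directional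
  derivatives of \<open>g\<close> in fixed directions, to which the induction hypothesis applies.\<close>

lemma Ck_on_compose:
  fixes f :: "'a::euclidean_space \<Rightarrow> 'b::euclidean_space"
  assumes "open S" "open T" "f ` S \<subseteq> T" "Ck_on k S f" "Ck_on k T g"
  shows "Ck_on k S (\<lambda>x. g (f x))"
  using assms(4,5)
proof (induction k arbitrary: g)
  case 0
  then show ?case using assms(3) by (auto intro: continuous_on_compose2)
next
  case (Suc k)
  let ?f' = "\<lambda>x. frechet_derivative f (at x)" and ?g' = "\<lambda>y. frechet_derivative g (at y)"
  show ?case
  proof (rule Ck_on_SucI[OF assms(1)])
    fix x assume x: "x \<in> S"
    have gx: "(g has_derivative ?g' (f x)) (at (f x))"
      using Ck_on_SucD(1)[OF Suc.prems(2)] x assms(3) by blast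
    have "((\<lambda>x. g (f x)) has_derivative (\<lambda>v. ?g' (f x) (?f' x v))) (at x)"
      using has_derivative_compose[OF Ck_on_SucD(1)[OF Suc.prems(1) x] gx] .
    moreover have "?g' (f x) (?f' x v) = (\<Sum>b\<in>Basis. (?f' x v \<bullet> b) *\<^sub>R ?g' (f x) b)" for v
    proof -
      interpret linear "?g' (f x)" using gx has_derivative_linear by blast
      have "?g' (f x) (?f' x v) = ?g' (f x) (\<Sum>b\<in>Basis. (?f' x v \<bullet> b) *\<^sub>R b)"
        by (simp add: euclidean_representation)
      then show ?thesis by (simp add: sum scale)
    qed
    ultimately show "((\<lambda>x. g (f x)) has_derivative
        (\<lambda>v. \<Sum>b\<in>Basis. (?f' x v \<bullet> b) *\<^sub>R ?g' (f x) b)) (at x)"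
      by simp
  next
    fix v
    show "Ck_on k S (\<lambda>x. \<Sum>b\<in>Basis. (?f' x v \<bullet> b) *\<^sub>R ?g' (f x) b)"
      by (intro Ck_on_sum Ck_on_scaleR Ck_on_inner Ck_on_const assms(1) Suc.IH
        Ck_on_SucD(2)[OF Suc.prems(1)] Ck_on_SucD(2)[OF Suc.prems(2)]
        Ck_on_Suc_imp[OF Suc.prems(1)])
  qed
qed

text \<open>The derivative of \<open>1 / f\<close> is again built from \<open>1 / f\<close> by products, so the order of differentiability
  climbs by induction.\<close>

lemma Ck_on_inverse:
  fixes f :: "'a::euclidean_space \<Rightarrow> real"
  assumes "open S" "Ck_on k S f" "\<And>x. x \<in> S \<Longrightarrow> f x \<noteq> 0"
  shows "Ck_on k S (\<lambda>x. inverse (f x))"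
  using assms(2)
proof (induction k)
  case 0
  then show ?case using assms(3) by (simp add: continuous_on_inverse)
next
  case (Suc k)
  show ?case
  proof (rule Ck_on_SucI[OF assms(1)])
    fix x assume "x \<in> S"
    then show "((\<lambda>x. inverse (f x)) has_derivative
      (\<lambda>v. (-1) * (inverse (f x) * frechet_derivative f (at x) v * inverse (f x)))) (at x)"
      using Deriv.has_derivative_inverse[OF assms(3) Ck_on_SucD(1)[OF Suc.prems]] by simp
  next
    fix v
    show "Ck_on k S (\<lambda>x. (-1) * (inverse (f x) * frechet_derivative f (at x) v * inverse (f x)))"
      by (intro Ck_on_mult Ck_on_const assms(1) Suc.IH Ck_on_SucD(2)[OF Suc.prems]
          Ck_on_Suc_imp[OF Suc.prems])
  qed
qed

lemma Ck_on_Suc_real: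
  fixes f :: "real \<Rightarrow> real"
  assumes "open S" "\<And>x. x \<in> S \<Longrightarrow> (f has_real_derivative f' x) (at x)" "Ck_on k S f'"
  shows "Ck_on (Suc k) S f"
proof (rule Ck_on_SucI[OF assms(1)])
  show "(f has_derivative (\<lambda>v. f' x * v)) (at x)" if "x \<in> S" for x
    using assms(2)[OF that] by (simp add: has_field_derivative_def)
qed (intro Ck_on_mult assms Ck_on_const)

section \<open>A smooth bump function\<close>

text \<open>With \<open>p = 1\<close> this is the classical smooth function \<open>exp (- 1 / t)\<close> that vanishes with all its
  derivatives at 0. The polynomial factor makes the family closed under differentiation, so that
  smoothness is one induction.\<close>

definition flat :: "real poly \<Rightarrow> real \<Rightarrow> real"
  where "flat p t = (if t > 0 then poly p (inverse t) * exp (- inverse t) else 0)"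

lemma poly_exp_tendsto_0: "((\<lambda>s. poly p s * exp (- s)) \<longlongrightarrow> (0::real)) at_top"
proof -
  have "((\<lambda>s. \<Sum>i\<le>degree p. coeff p i * (s ^ i / exp s)) \<longlongrightarrow> (\<Sum>i\<le>degree p. coeff p i * 0)) at_top"
    by (intro tendsto_sum tendsto_mult tendsto_const tendsto_power_div_exp_0)
  then show ?thesis
    by (simp add: poly_altdef sum_distrib_right exp_minus divide_inverse mult.assoc)
qed

lemma flat_tendsto_0: "(flat p \<longlongrightarrow> 0) (at 0)"
proof -
  have "((\<lambda>t. poly p (inverse t) * exp (- inverse t)) \<longlongrightarrow> 0) (at_right 0)"
    using filterlim_compose[OF poly_exp_tendsto_0 filterlim_inverse_at_top_right] .
  then have "(flat p \<longlongrightarrow> 0) (at_right 0)"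
    by (rule Lim_transform_eventually) (simp add: flat_def eventually_at_right_less eventually_at_filter)
  moreover have "(flat p \<longlongrightarrow> 0) (at_left 0)"
    by (rule tendsto_eventually) (simp add: flat_def eventually_at_filter)
  ultimately show ?thesis using filterlim_split_at by blast
qed

lemma flat_deriv:
  "(flat p has_real_derivative flat (monom 1 2 * (p - pderiv p)) t) (at t)"
proof -
  consider "t < 0" | "t = 0" | "t > 0" by linarith
  then show ?thesis
  proof cases
    case 1
    have "((\<lambda>t. 0) has_real_derivative flat (monom 1 2 * (p - pderiv p)) t) (at t)"
      using 1 by (simp add: flat_def)
    then show ?thesis
      by (rule has_field_derivative_transform_within_open[where S = "{..<0}"])
        (use 1 in \<open>auto simp: flat_def\<close>)
  next
    case 2
    have "((\<lambda>h. (flat p h - flat p 0) / (h - 0)) \<longlongrightarrow> 0) (at 0)"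
      by (rule Lim_transform_eventually[OF flat_tendsto_0[of "monom 1 1 * p"]])
        (auto simp: flat_def eventually_at_filter poly_monom divide_inverse)
    then show ?thesis
      using 2 by (simp add: has_field_derivative_iff flat_def)
  next
    case 3
    have "((\<lambda>t. poly p (inverse t) * exp (- inverse t)) has_real_derivative
        flat (monom 1 2 * (p - pderiv p)) t) (at t)"
      using 3 by (auto intro!: derivative_eq_intros DERIV_chain2[OF poly_DERIV]
        simp: flat_def poly_monom algebra_simps power2_eq_square)
    then show ?thesis
      by (rule has_field_derivative_transform_within_open[where S = "{0<..}"])
        (use 3 in \<open>auto simp: flat_def\<close>)
  qed
qed

lemma Ck_on_flat: "Ck_on k UNIV (flat p)"
proof (induction k arbitrary: p)
  case 0
  then show ?case
    by (auto intro!: continuous_at_imp_continuous_on DERIV_isCont flat_deriv)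
next
  case (Suc k)
  show ?case by (rule Ck_on_Suc_real[OF _ flat_deriv Suc]) auto
qed

text \<open>With \<open>h = flat 1\<close>, positive exactly on the positive reals, and \<open>d\<close> the distance to \<open>c\<close>, the bump is
  \<open>h (s\<^sup>2 - d\<^sup>2) / (h (s\<^sup>2 - d\<^sup>2) + h (d\<^sup>2 - r\<^sup>2))\<close>. As \<open>r < s\<close>, one of the two arguments is positive
  everywhere and the denominator never vanishes.\<close>

lemma euclidean_bump:
  fixes c :: "'e::euclidean_space"
  assumes "0 < r" "r < s"
  obtains \<psi> :: "'e \<Rightarrow> real"
  where "smooth_on UNIV \<psi>" "\<And>y. dist c y \<le> r \<Longrightarrow> \<psi> y = 1" "\<And>y. s \<le> dist c y \<Longrightarrow> \<psi> y = 0"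
proof
  define u where "u = (\<lambda>y::'e. s^2 + (-1) * ((y - c) \<bullet> (y - c)))"
  define w where "w = (\<lambda>y::'e. - (r^2) + ((y - c) \<bullet> (y - c)))"
  define \<psi> where "\<psi> = (\<lambda>y. flat 1 (u y) * inverse (flat 1 (u y) + flat 1 (w y)))"
  have nn: "(y - c) \<bullet> (y - c) = (dist c y)^2" for y
    by (simp add: dist_norm norm_minus_commute dot_square_norm)
  have rs: "r\<^sup>2 < s\<^sup>2" using assms by (simp add: power_strict_mono)
  have pos: "0 < flat 1 (u y) + flat 1 (w y)" for y
    using rs by (auto simp: flat_def u_def w_def add_pos_nonneg add_nonneg_pos)
  have lin: "Ck_on k UNIV (\<lambda>y. y - c)" for k
    using Ck_on_add[OF open_UNIV Ck_on_bounded_linear[OF bounded_linear_ident] Ck_on_const[of k UNIV "- c"]]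
    by simp
  have "Ck_on k UNIV u" "Ck_on k UNIV w" for k
    unfolding u_def w_def
    by (intro Ck_on_add Ck_on_mult Ck_on_const Ck_on_inner lin open_UNIV)+
  then have "Ck_on k UNIV (\<lambda>y. flat 1 (u y))" "Ck_on k UNIV (\<lambda>y. flat 1 (w y))" for k
    using Ck_on_compose[OF open_UNIV open_UNIV _ _ Ck_on_flat] by blast+
  then have "Ck_on k UNIV \<psi>" for k
    unfolding \<psi>_def using pos
    by (intro Ck_on_mult Ck_on_inverse Ck_on_add open_UNIV) (auto simp: less_imp_neq[symmetric])
  then show "smooth_on UNIV \<psi>" by (simp add: smooth_on_def)
  show "\<psi> y = 1" if "dist c y \<le> r" for y
  proof -
    have "(dist c y)^2 \<le> r^2" using that by (simp add: power_mono)
    then have "flat 1 (w y) = 0" by (simp add: flat_def w_def nn)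
    then show ?thesis using pos[of y] by (simp add: \<psi>_def)
  qed
  show "\<psi> y = 0" if "s \<le> dist c y" for y
  proof -
    have "s^2 \<le> (dist c y)^2" using that assms by (simp add: power_mono)
    then show ?thesis by (simp add: flat_def u_def \<psi>_def nn)
  qed
qed

section \<open>Hadamard's lemma\<close>

text \<open>Differentiating under the integral sign brings out one factor \<open>t\<close> from the inner function. The
  weight \<open>t ^ m\<close> absorbs it, which makes the statement inductive in \<open>k\<close>. Convexity keeps the segment
  from \<open>c\<close> to \<open>y\<close> inside \<open>S\<close>.\<close>

lemma Ck_on_ray_integral:
  fixes c :: "'e::euclidean_space" and f :: "'e \<Rightarrow> real"
  assumes "open S" "convex S" "c \<in> S" "Ck_on k S f"
  shows "Ck_on k S (\<lambda>y. integral (cbox 0 1) (\<lambda>t::real. t ^ m * f (c + t *\<^sub>R (y - c))))"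
  using assms(4)
proof (induction k arbitrary: f m)
  note seg = convexD_alt[OF assms(2,3)]
  have ray: "c + t *\<^sub>R (y - c) \<in> S" if "y \<in> S" "t \<in> cbox 0 1" for y and t :: real
    using seg[OF that(1), of t] that(2) by (simp add: algebra_simps)
  have cont: "continuous_on (S \<times> cbox 0 1) (\<lambda>(y, t). t ^ n * h (c + t *\<^sub>R (y - c)))"
    if "continuous_on S h" for n and h :: "'e \<Rightarrow> real"
    unfolding split_beta
    by (intro continuous_intros continuous_on_compose2[OF that]) (use ray in auto)
  {
    case 0
    show ?case using integral_continuous_on_param[OF cont] 0 by simp
  next
    case (Suc k)
    let ?f' = "\<lambda>y. frechet_derivative f (at y)"
    have bl: "bounded_linear (?f' y)" if "y \<in> S" for y
      using Ck_on_SucD(1)[OF Suc.prems that] has_derivative_bounded_linear by blast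
    \<comment> \<open>The derivative of the integrand as a map into the bounded linear maps. Its continuity there is checked on basis vectors.\<close>
    define L where "L = (\<lambda>y t. Blinfun (\<lambda>v. t ^ Suc m * ?f' (c + t *\<^sub>R (y - c)) v))"
    have L: "blinfun_apply (L y t) v = t ^ Suc m * ?f' (c + t *\<^sub>R (y - c)) v"
      if "y \<in> S" "t \<in> cbox 0 1" for y t v
      unfolding L_def
      by (subst bounded_linear_Blinfun_apply)
        (auto intro: bounded_linear_const_mult bl ray that simp del: power_Suc)
    have contf: "continuous_on S f"
      using Suc.prems Ck_on_Suc_imp Ck_on.simps(1)
      by (auto intro!: continuous_at_imp_continuous_on differentiable_imp_continuous_within)
    have contL: "continuous_on (S \<times> cbox 0 1) (\<lambda>(y, t). L y t)"
    proof (rule continuous_on_blinfun_componentwise)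
      fix b :: 'e
      have "Ck_on 0 S (\<lambda>y. ?f' y b)"
      proof -
        have "Ck_on j S h \<Longrightarrow> Ck_on 0 S h" for j and h :: "'e \<Rightarrow> real"
          by (induction j) (use Ck_on_Suc_imp in blast)+
        then show ?thesis using Ck_on_SucD(2)[OF Suc.prems] by blast
      qed
      then have "continuous_on (S \<times> cbox 0 1) (\<lambda>(y, t). t ^ Suc m * ?f' (c + t *\<^sub>R (y - c)) b)"
        using cont[of "\<lambda>y. ?f' y b" "Suc m"] by (simp del: power_Suc)
      then show "continuous_on (S \<times> cbox 0 1) (\<lambda>x. blinfun_apply (case x of (y, t) \<Rightarrow> L y t) b)"
        by (rule continuous_on_eq) (use L in auto)
    qed
    show ?case
    proof (rule Ck_on_SucI[OF assms(1)])
      fix y assume y: "y \<in> S"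
      have "((\<lambda>y. integral (cbox 0 1) (\<lambda>t. t ^ m * f (c + t *\<^sub>R (y - c)))) has_derivative
          blinfun_apply (integral (cbox 0 1) (L y))) (at y within S)"
      proof (rule leibniz_rule[OF _ _ contL y assms(2)])
        fix z and t :: real assume z: "z \<in> S" "t \<in> cbox 0 1"
        have "((\<lambda>z. f (c + t *\<^sub>R (z - c))) has_derivative
            (\<lambda>v. ?f' (c + t *\<^sub>R (z - c)) (t *\<^sub>R v))) (at z)"
          by (rule has_derivative_compose[where f = "\<lambda>z. c + t *\<^sub>R (z - c)" and g = f,
              OF _ Ck_on_SucD(1)[OF Suc.prems ray[OF z]]])
            (auto intro!: derivative_eq_intros)
        then have "((\<lambda>z. t ^ m * f (c + t *\<^sub>R (z - c))) has_derivative
            (\<lambda>v. t ^ m * ?f' (c + t *\<^sub>R (z - c)) (t *\<^sub>R v))) (at z)"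
          by (rule has_derivative_mult_right)
        moreover have "(\<lambda>v. t ^ m * ?f' (c + t *\<^sub>R (z - c)) (t *\<^sub>R v)) = blinfun_apply (L z t)"
          using L[OF z] bounded_linear.linear[OF bl[OF ray[OF z]]]
          by (auto simp: fun_eq_iff linear_cmul)
        ultimately show "((\<lambda>z. t ^ m * f (c + t *\<^sub>R (z - c))) has_derivative
            blinfun_apply (L z t)) (at z within S)"
          by (simp add: has_derivative_at_withinI)
      next
        fix z assume z: "z \<in> S"
        show "(\<lambda>t. t ^ m * f (c + t *\<^sub>R (z - c))) integrable_on cbox 0 1"
          by (intro integrable_continuous continuous_intros continuous_on_compose2[OF contf])
            (use ray z in auto)
      qed
      moreover have "blinfun_apply (integral (cbox 0 1) (L y)) =
          (\<lambda>v. integral (cbox 0 1) (\<lambda>t. t ^ Suc m * ?f' (c + t *\<^sub>R (y - c)) v))"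
      proof
        fix v
        have "continuous_on (cbox 0 (1::real)) (Pair y)" by (intro continuous_intros)
        then have "continuous_on (cbox 0 1) (L y)"
          using continuous_on_compose2[OF contL, of "cbox 0 1" "Pair y"] y by auto
        then have "L y integrable_on cbox 0 1" by (rule integrable_continuous)
        then have "blinfun_apply (integral (cbox 0 1) (L y)) v =
            integral (cbox 0 1) (\<lambda>t. blinfun_apply (L y t) v)"
          using integral_linear[OF _ blinfun.bounded_linear_left, of "L y" "cbox 0 1" v]
          by (simp add: o_def)
        then show "blinfun_apply (integral (cbox 0 1) (L y)) v =
            integral (cbox 0 1) (\<lambda>t. t ^ Suc m * ?f' (c + t *\<^sub>R (y - c)) v)"
          using integral_cong[of "cbox 0 1" "\<lambda>t. blinfun_apply (L y t) v", OF L[OF y]] by simp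
      qed
      ultimately show "((\<lambda>y. integral (cbox 0 1) (\<lambda>t. t ^ m * f (c + t *\<^sub>R (y - c)))) has_derivative
          (\<lambda>v. integral (cbox 0 1) (\<lambda>t. t ^ Suc m * ?f' (c + t *\<^sub>R (y - c)) v))) (at y)"
        using at_within_open[OF y assms(1)] by (simp only:)
    next
      fix v
      show "Ck_on k S (\<lambda>y. integral (cbox 0 1) (\<lambda>t. t ^ Suc m * ?f' (c + t *\<^sub>R (y - c)) v))"
        by (rule Suc.IH[OF Ck_on_SucD(2)[OF Suc.prems]])
    qed
  }
qed

lemma smooth_on_frechet_derivative:
  "smooth_on S f \<Longrightarrow> smooth_on S (\<lambda>x. frechet_derivative f (at x) v)"
  unfolding smooth_on_def using Ck_on_SucD(2) by blast

lemma smooth_on_has_derivative: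
  "smooth_on S f \<Longrightarrow> x \<in> S \<Longrightarrow> (f has_derivative frechet_derivative f (at x)) (at x)"
  unfolding smooth_on_def using Ck_on_SucD(1) by blast

lemma smooth_on_imp_continuous_on: "smooth_on S f \<Longrightarrow> continuous_on S f"
  unfolding smooth_on_def using Ck_on.simps(1) by blast

text \<open>Integrating the derivative of \<open>f\<close> along the segment from \<open>c\<close> to \<open>y\<close> gives \<open>f y - f c\<close>; the
  coefficient of \<open>(y - c) \<bullet> b\<close> is the integral of the partial derivative in direction \<open>b\<close>. This is what
  determines a derivation at a point by finitely many numbers: all derivations kill the constant
  \<open>f c\<close>, and each product is differentiated at a zero of its first factor.\<close>

lemma hadamard:
  fixes f :: "'e::euclidean_space \<Rightarrow> real"
  assumes "open S" "convex S" "c \<in> S" "smooth_on S f"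
  obtains h where "\<And>b. smooth_on S (h b)"
    "\<And>y. y \<in> S \<Longrightarrow> f y = f c + (\<Sum>b\<in>Basis. ((y - c) \<bullet> b) * h b y)"
    "\<And>b. h b c = frechet_derivative f (at c) b"
proof
  let ?f' = "\<lambda>y. frechet_derivative f (at y)"
  define h where "h = (\<lambda>b y. integral (cbox 0 1) (\<lambda>t::real. t ^ 0 * ?f' (c + t *\<^sub>R (y - c)) b))"
  show "smooth_on S (h b)" for b
    unfolding smooth_on_def h_def
    using smooth_on_frechet_derivative[OF assms(4)]
    by (intro allI Ck_on_ray_integral[OF assms(1-3)]) (simp add: smooth_on_def)
  show "h b c = ?f' c b" for b by (simp add: h_def)
  fix y assume y: "y \<in> S"
  have ray: "c + t *\<^sub>R (y - c) \<in> S" if "t \<in> cbox 0 1" for t :: real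
    using convexD_alt[OF assms(2,3) y, of t] that by (simp add: algebra_simps)
  have cont: "continuous_on (cbox 0 1) (\<lambda>t::real. ?f' (c + t *\<^sub>R (y - c)) b)" for b
    by (intro continuous_intros continuous_on_compose2[OF
        smooth_on_imp_continuous_on[OF smooth_on_frechet_derivative[OF assms(4)]]])
      (use ray in auto)
  have "((\<lambda>t. ?f' (c + t *\<^sub>R (y - c)) (y - c)) has_integral
      f (c + 1 *\<^sub>R (y - c)) - f (c + 0 *\<^sub>R (y - c))) {0..1}"
  proof (rule fundamental_theorem_of_calculus)
    fix t :: real assume "t \<in> {0..1}"
    then have t: "t \<in> cbox 0 1" by simp
    have D: "(f has_derivative ?f' (c + t *\<^sub>R (y - c))) (at (c + t *\<^sub>R (y - c)))"
      by (rule smooth_on_has_derivative[OF assms(4) ray[OF t]])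
    have "((\<lambda>t. f (c + t *\<^sub>R (y - c))) has_derivative
        (\<lambda>s. ?f' (c + t *\<^sub>R (y - c)) (s *\<^sub>R (y - c)))) (at t)"
      by (rule has_derivative_compose[where f = "\<lambda>t. c + t *\<^sub>R (y - c)" and g = f, OF _ D]) (auto intro!: derivative_eq_intros)
    then show "((\<lambda>t. f (c + t *\<^sub>R (y - c))) has_vector_derivative
        ?f' (c + t *\<^sub>R (y - c)) (y - c)) (at t within {0..1})"
      unfolding has_vector_derivative_def using has_derivative_linear[OF D]
      by (auto intro: has_derivative_at_withinI simp: linear_cmul)
  qed simp
  then have "f y - f c = integral (cbox 0 1) (\<lambda>t. ?f' (c + t *\<^sub>R (y - c)) (y - c))"
    by (simp add: integral_unique)
  also have "\<dots> = integral (cbox 0 1)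
      (\<lambda>t. \<Sum>b\<in>Basis. ((y - c) \<bullet> b) * ?f' (c + t *\<^sub>R (y - c)) b)"
  proof (rule integral_cong)
    fix t :: real assume t: "t \<in> cbox 0 1"
    interpret linear "?f' (c + t *\<^sub>R (y - c))"
      using has_derivative_linear[OF smooth_on_has_derivative[OF assms(4) ray[OF t]]] .
    have "?f' (c + t *\<^sub>R (y - c)) (\<Sum>b\<in>Basis. ((y - c) \<bullet> b) *\<^sub>R b) =
        (\<Sum>b\<in>Basis. ((y - c) \<bullet> b) * ?f' (c + t *\<^sub>R (y - c)) b)"
      by (simp add: sum scale)
    then show "?f' (c + t *\<^sub>R (y - c)) (y - c) =
        (\<Sum>b\<in>Basis. ((y - c) \<bullet> b) * ?f' (c + t *\<^sub>R (y - c)) b)"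
      by (simp only: euclidean_representation)
  qed
  also have "\<dots> = (\<Sum>b\<in>Basis. ((y - c) \<bullet> b) * h b y)"
  proof -
    have "(\<lambda>t. ((y - c) \<bullet> b) * ?f' (c + t *\<^sub>R (y - c)) b) integrable_on cbox 0 1" for b
      by (intro integrable_continuous continuous_on_mult continuous_on_const cont)
    then show ?thesis
      by (subst integral_sum) (auto simp: h_def)
  qed
  finally show "f y = f c + (\<Sum>b\<in>Basis. ((y - c) \<bullet> b) * h b y)" by simp
qed

section \<open>Linear forms and pointwise sums\<close>

lemma linear_form_on_sum:
  assumes "linear_form_on T L" "subspace T" "\<And>i. i \<in> I \<Longrightarrow> v i \<in> T"
  shows "L (\<Sum>i\<in>I. c i *\<^sub>R v i) = (\<Sum>i\<in>I. c i * L (v i))"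
  using assms(3)
proof (induction I rule: infinite_finite_induct)
  case (insert i I)
  then have "(\<Sum>i\<in>I. c i *\<^sub>R v i) \<in> T" "c i *\<^sub>R v i \<in> T"
    using assms(2) by (auto intro: subspace_sum subspace_scale)
  then show ?case using insert assms(1) by (simp add: linear_form_on_def)
next
  case empty
  have "L (0 *\<^sub>R 0) = 0 * L 0"
    using assms(1,2) subspace_0 unfolding linear_form_on_def by blast
  then show ?case by simp
next
  case (infinite I)
  have "L (0 *\<^sub>R 0) = 0 * L 0"
    using assms(1,2) subspace_0 unfolding linear_form_on_def by blast
  then show ?case using infinite by simp
qed

lemma linear_form_on_diff:
  assumes "linear_form_on T L" "subspace T" "v \<in> T" "w \<in> T"
  shows "L (v - w) = L v - L w"
proof -
  have "L (v + (-1) *\<^sub>R w) = L v + (-1) * L w"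
    using assms subspace_scale[OF assms(2,4), of "-1"] unfolding linear_form_on_def by metis
  then show ?thesis by simp
qed

lemma scaleR_fun_apply: "(c *\<^sub>R f) x = c *\<^sub>R f x"
  by (simp add: scaleR_fun_def)

lemma fun_scale_apply: "fun_scale f X p = f p *\<^sub>R X p"
  by (simp add: fun_scale_def)

lemma sum_field_apply: "(\<Sum>i\<in>I. (F i :: 'a field)) p = (\<Sum>i\<in>I. F i p)"
  by (induction I rule: infinite_finite_induct) auto

lemma sum_tangent_apply: "(\<Sum>i\<in>I. (v i :: 'a tangent_vector)) f = (\<Sum>i\<in>I. v i f)"
  by (induction I rule: infinite_finite_induct) auto

section \<open>Smooth functions on a manifold\<close>

locale smooth_manifold =
  fixes A :: "('a::{t2_space,second_countable_topology}, 'e::euclidean_space) chart set"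
  assumes atlas: "smooth_atlas A"
begin

lemma chart:
  assumes "(U, \<phi>) \<in> A"
  shows chart_open: "open U" and chart_image: "open (\<phi> ` U)"
    and chart_inj: "inj_on \<phi> U"
    and chart_continuous: "continuous_on U \<phi>"
    and chart_continuous_inv: "continuous_on (\<phi> ` U) (inv_into U \<phi>)"
proof -
  have "is_chart (U, \<phi>)" using assms atlas by (auto simp: smooth_atlas_def)
  then have "open U" "open (\<phi> ` U)" "homeomorphism U (\<phi> ` U) \<phi> (inv_into U \<phi>)"
    by (auto simp: is_chart_def)
  then show "open U" "open (\<phi> ` U)" "inj_on \<phi> U" "continuous_on U \<phi>"
    "continuous_on (\<phi> ` U) (inv_into U \<phi>)"
    by (auto simp: homeomorphism_def intro: inj_on_inverseI)
qed

lemma chart_at: obtains U \<phi> where "(U, \<phi>) \<in> A" "p \<in> U"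
proof -
  have "p \<in> (\<Union>(U, \<phi>)\<in>A. U)" using atlas by (simp add: smooth_atlas_def)
  then show thesis using that by auto
qed

lemma chart_inv [simp]: "(U, \<phi>) \<in> A \<Longrightarrow> p \<in> U \<Longrightarrow> inv_into U \<phi> (\<phi> p) = p"
  by (simp add: chart_inj)

lemma chart_open_image:
  assumes "(U, \<phi>) \<in> A" "open V" "V \<subseteq> U"
  shows "open (\<phi> ` V)"
proof -
  have "\<phi> ` V = \<phi> ` U \<inter> inv_into U \<phi> -` V"
  proof (intro equalityI subsetI)
    fix y assume "y \<in> \<phi> ` U \<inter> inv_into U \<phi> -` V"
    then obtain u where "u \<in> U" "y = \<phi> u" "u \<in> V" using assms(1) by auto
    then show "y \<in> \<phi> ` V" by blast
  qed (use assms in auto)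
  then show ?thesis
    using continuous_open_preimage[OF chart_continuous_inv chart_image] assms by auto
qed

lemma chart_transition:
  assumes "(U, \<phi>) \<in> A" "(V, \<psi>) \<in> A"
  shows "smooth_on (\<phi> ` (U \<inter> V)) (\<psi> \<circ> inv_into U \<phi>)"
proof -
  have "\<forall>(U, \<phi>)\<in>A. \<forall>(V, \<psi>)\<in>A. smooth_on (\<phi> ` (U \<inter> V)) (\<psi> \<circ> inv_into U \<phi>)"
    using atlas by (simp add: smooth_atlas_def)
  from bspec[OF this assms(1)] have "\<forall>(V, \<psi>)\<in>A. smooth_on (\<phi> ` (U \<inter> V)) (\<psi> \<circ> inv_into U \<phi>)"
    by simp
  from bspec[OF this assms(2)] show ?thesis by simp
qed

lemma chart_open_preimage:
  assumes "(U, \<phi>) \<in> A" "open V"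
  shows "open (U \<inter> \<phi> -` V)"
  using continuous_open_preimage[OF chart_continuous chart_open] assms by auto

lemma smooth_functionsD:
  "f \<in> smooth_functions A \<Longrightarrow> (U, \<phi>) \<in> A \<Longrightarrow> smooth_on (\<phi> ` U) (f \<circ> inv_into U \<phi>)"
  by (auto simp: smooth_functions_def)

lemma smooth_functionsI:
  "(\<And>U \<phi> k. (U, \<phi>) \<in> A \<Longrightarrow> Ck_on k (\<phi> ` U) (\<lambda>y. f (inv_into U \<phi> y))) \<Longrightarrow> f \<in> smooth_functions A"
  by (auto simp: smooth_functions_def smooth_on_def o_def)

lemma smooth_functions_Ck:
  "f \<in> smooth_functions A \<Longrightarrow> (U, \<phi>) \<in> A \<Longrightarrow> Ck_on k (\<phi> ` U) (\<lambda>y. f (inv_into U \<phi> y))"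
  by (auto simp: smooth_functions_def smooth_on_def o_def)

lemma smooth_functions_local:
  assumes "\<And>p. \<exists>W h. open W \<and> p \<in> W \<and> h \<in> smooth_functions A \<and> (\<forall>q\<in>W. f q = h q)"
  shows "f \<in> smooth_functions A"
proof (rule smooth_functionsI, rule Ck_on_local)
  fix U \<phi> k y assume c: "(U, \<phi>) \<in> A" and "y \<in> \<phi> ` U"
  then obtain p where p: "p \<in> U" "y = \<phi> p" by auto
  obtain W h where W: "open W" "p \<in> W" and h: "h \<in> smooth_functions A" and e: "\<forall>q\<in>W. f q = h q"
    using assms by blast
  have o: "open (\<phi> ` (U \<inter> W))"
    by (rule chart_open_image[OF c]) (use chart_open[OF c] W in auto)
  have "Ck_on k (\<phi> ` (U \<inter> W)) (\<lambda>y. h (inv_into U \<phi> y))"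
    by (rule Ck_on_subset[OF smooth_functions_Ck[OF h c]]) auto
  then have "Ck_on k (\<phi> ` (U \<inter> W)) (\<lambda>y. f (inv_into U \<phi> y))"
    by (rule Ck_on_cong_imp[OF o, rotated]) (use c e in auto)
  then show "\<exists>T. open T \<and> y \<in> T \<and> Ck_on k T (\<lambda>y. f (inv_into U \<phi> y))"
    using o p W by blast
qed

lemma smooth_const [simp]: "(\<lambda>p. c) \<in> smooth_functions A"
  by (rule smooth_functionsI) (rule Ck_on_const)

lemma smooth_add:
  "f \<in> smooth_functions A \<Longrightarrow> h \<in> smooth_functions A \<Longrightarrow> (\<lambda>p. f p + h p) \<in> smooth_functions A"
  by (rule smooth_functionsI, rule Ck_on_add[OF chart_image]) (auto intro: smooth_functions_Ck)

lemma smooth_mult: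
  "f \<in> smooth_functions A \<Longrightarrow> h \<in> smooth_functions A \<Longrightarrow> (\<lambda>p. f p * h p) \<in> smooth_functions A"
  by (rule smooth_functionsI, rule Ck_on_mult[OF chart_image]) (auto intro: smooth_functions_Ck)

lemma smooth_diff:
  "f \<in> smooth_functions A \<Longrightarrow> h \<in> smooth_functions A \<Longrightarrow> (\<lambda>p. f p - h p) \<in> smooth_functions A"
  using smooth_add[of f "\<lambda>p. (-1) * h p"] smooth_mult[OF smooth_const, of h "-1"] by simp

lemma smooth_sum:
  "(\<And>i. i \<in> I \<Longrightarrow> f i \<in> smooth_functions A) \<Longrightarrow> (\<lambda>p. \<Sum>i\<in>I. f i p) \<in> smooth_functions A"
  by (induction I rule: infinite_finite_induct) (auto simp: smooth_add)

lemma smooth_prod: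
  "(\<And>i. i \<in> I \<Longrightarrow> f i \<in> smooth_functions A) \<Longrightarrow> (\<lambda>p. \<Prod>i\<in>I. f i p) \<in> smooth_functions A"
  by (induction I rule: infinite_finite_induct) (auto simp: smooth_mult)

lemma smooth_inverse:
  "f \<in> smooth_functions A \<Longrightarrow> (\<And>p. f p \<noteq> 0) \<Longrightarrow> (\<lambda>p. inverse (f p)) \<in> smooth_functions A"
  by (rule smooth_functionsI, rule Ck_on_inverse[OF chart_image]) (auto intro: smooth_functions_Ck)

lemma smooth_continuous:
  assumes "f \<in> smooth_functions A"
  shows "continuous_on UNIV f"
proof -
  have "isCont f p" for p
  proof -
    obtain U \<phi> where c: "(U, \<phi>) \<in> A" "p \<in> U" by (rule chart_at)
    have "continuous_on U (\<lambda>q. (f \<circ> inv_into U \<phi>) (\<phi> q))"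
      by (rule continuous_on_compose2[OF smooth_on_imp_continuous_on[OF smooth_functionsD[OF assms c(1)]]
            chart_continuous[OF c(1)]]) simp
    then have "continuous_on U f"
      by (rule continuous_on_eq) (use c in auto)
    then show ?thesis
      using c chart_open[OF c(1)] continuous_on_eq_continuous_at by blast
  qed
  then show ?thesis by (simp add: continuous_at_imp_continuous_on)
qed

text \<open>Near a point of \<open>U\<close> the extension is \<open>m\<close> composed with a change of charts. A point outside \<open>U\<close> is
  outside the preimage of \<open>K\<close> as well, which is compact and therefore closed (the space is Hausdorff),
  and off this closed set the extension vanishes.\<close>

lemma smooth_extend_by_zero:
  fixes m :: "'e \<Rightarrow> real"
  assumes c: "(U, \<phi>) \<in> A" and K: "compact K" "K \<subseteq> \<phi> ` U"
    and m: "smooth_on UNIV m" "\<And>y. y \<notin> K \<Longrightarrow> m y = 0"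
  shows "(\<lambda>q. if q \<in> U then m (\<phi> q) else 0) \<in> smooth_functions A"
    (is "?F \<in> _")
proof (rule smooth_functionsI, rule Ck_on_local)
  fix V \<psi> k y assume d: "(V, \<psi>) \<in> A" and "y \<in> \<psi> ` V"
  then obtain x where x: "x \<in> V" "y = \<psi> x" by auto
  show "\<exists>T. open T \<and> y \<in> T \<and> Ck_on k T (\<lambda>y. ?F (inv_into V \<psi> y))"
  proof (cases "x \<in> U")
    case True
    have o: "open (\<psi> ` (V \<inter> U))"
      by (rule chart_open_image[OF d]) (use chart_open[OF c] chart_open[OF d] in auto)
    have "smooth_on (\<psi> ` (V \<inter> U)) (\<phi> \<circ> inv_into V \<psi>)"
      by (rule chart_transition[OF d c])
    then have "Ck_on k (\<psi> ` (V \<inter> U)) (\<lambda>y. m ((\<phi> \<circ> inv_into V \<psi>) y))"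
      using Ck_on_compose[OF o open_UNIV subset_UNIV, of k "\<phi> \<circ> inv_into V \<psi>" m] m(1)
      by (simp add: smooth_on_def)
    then have "Ck_on k (\<psi> ` (V \<inter> U)) (\<lambda>y. ?F (inv_into V \<psi> y))"
      by (rule Ck_on_cong_imp[OF o, rotated]) (use d in auto)
    then show ?thesis using o x True by blast
  next
    case False
    define L where "L = inv_into U \<phi> ` K"
    have "compact L"
      unfolding L_def
      by (rule compact_continuous_image[OF continuous_on_subset[OF chart_continuous_inv[OF c] K(2)] K(1)])
    then have "closed L" by (rule compact_imp_closed)
    have LU: "L \<subseteq> U" using K(2) c by (auto simp: L_def inv_into_into subset_iff)
    have o: "open (\<psi> ` (V - L))"
      by (rule chart_open_image[OF d]) (use chart_open[OF d] \<open>closed L\<close> in auto)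
    have F0: "?F q = 0" if "q \<notin> L" for q
    proof (cases "q \<in> U")
      case True
      have "\<phi> q \<notin> K"
      proof
        assume "\<phi> q \<in> K"
        then have "inv_into U \<phi> (\<phi> q) \<in> L" by (simp add: L_def)
        then show False using that c True by simp
      qed
      then show ?thesis using m(2) by simp
    qed simp
    have "Ck_on k (\<psi> ` (V - L)) (\<lambda>y. ?F (inv_into V \<psi> y))"
    proof (rule Ck_on_cong_imp[OF o _ Ck_on_const])
      fix y assume "y \<in> \<psi> ` (V - L)"
      then obtain q where q: "y = \<psi> q" "q \<in> V" "q \<notin> L" by blast
      then show "0 = ?F (inv_into V \<psi> y)"
        using F0[OF q(3)] by (simp only: q chart_inv[OF d q(2)])
    qed
    then show ?thesis using o x False LU by blast
  qed
qed

text \<open>Bump functions make everything local: they show that derivations see only germs and that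
  tensorial expressions see only values at a point.\<close>

lemma bump:
  assumes "open W" "p \<in> W"
  obtains \<rho> V where "\<rho> \<in> smooth_functions A" "open V" "p \<in> V" "V \<subseteq> W"
    "\<And>q. q \<in> V \<Longrightarrow> \<rho> q = 1" "\<And>q. q \<notin> W \<Longrightarrow> \<rho> q = 0"
proof -
  obtain U \<phi> where c: "(U, \<phi>) \<in> A" "p \<in> U" by (rule chart_at)
  have "open (\<phi> ` (U \<inter> W))"
    by (rule chart_open_image[OF c(1)]) (use chart_open[OF c(1)] assms in auto)
  then obtain s where s: "s > 0" "cball (\<phi> p) s \<subseteq> \<phi> ` (U \<inter> W)"
    using c assms open_contains_cball by blast
  obtain \<psi> :: "'e \<Rightarrow> real" where \<psi>: "smooth_on UNIV \<psi>" "\<And>y. dist (\<phi> p) y \<le> s / 2 \<Longrightarrow> \<psi> y = 1"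
      "\<And>y. s \<le> dist (\<phi> p) y \<Longrightarrow> \<psi> y = 0"
    using euclidean_bump[of "s / 2" s "\<phi> p"] s by auto
  have W: "q \<in> W" if "q \<in> U" "dist (\<phi> p) (\<phi> q) \<le> s" for q
  proof -
    have "\<phi> q \<in> \<phi> ` (U \<inter> W)" using s(2) that by auto
    then show ?thesis using inj_on_image_mem_iff[OF chart_inj[OF c(1)] that(1), of "U \<inter> W"] by auto
  qed
  show thesis
  proof
    show "(\<lambda>q. if q \<in> U then \<psi> (\<phi> q) else 0) \<in> smooth_functions A"
      by (rule smooth_extend_by_zero[OF c(1), of "cball (\<phi> p) s"]) (use s \<psi> in auto)
    show "open (U \<inter> \<phi> -` ball (\<phi> p) (s / 2))"
      by (rule chart_open_preimage[OF c(1)]) simp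
    show "U \<inter> \<phi> -` ball (\<phi> p) (s / 2) \<subseteq> W" using W s by auto
    show "(if q \<in> U then \<psi> (\<phi> q) else 0) = 0" if "q \<notin> W" for q
      using W[of q] \<psi>(3)[of "\<phi> q"] that by fastforce
  qed (use c s \<psi> in auto)
qed

text \<open>Cramer's rule divides by a determinant that is nonzero only near \<open>p\<close>; this supplies the
  quotient as a global smooth function.\<close>

lemma local_reciprocal:
  assumes "f \<in> smooth_functions A" "f p \<noteq> 0"
  obtains h W where "h \<in> smooth_functions A" "open W" "p \<in> W" "\<And>q. q \<in> W \<Longrightarrow> h q * f q = 1"
proof -
  have o: "open {q. f q \<noteq> 0}"
    using open_Collect_neq[OF smooth_continuous[OF assms(1)] continuous_on_const] by simp
  obtain \<rho> V where \<rho>: "\<rho> \<in> smooth_functions A" "open V" "p \<in> V" "V \<subseteq> {q. f q \<noteq> 0}"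
    "\<And>q. q \<in> V \<Longrightarrow> \<rho> q = 1" "\<And>q. q \<notin> {q. f q \<noteq> 0} \<Longrightarrow> \<rho> q = 0"
    by (rule bump[OF o, of p]) (use assms(2) in blast)+
  \<comment> \<open>This sum of squares equals \<open>f\<^sup>2\<close> near \<open>p\<close>, and where \<open>f\<close> vanishes so does \<open>\<rho>\<close>, leaving 1.\<close>
  define d where "d = (\<lambda>q. f q * f q + (1 - \<rho> q) * (1 - \<rho> q))"
  have "d q \<noteq> 0" for q
    using \<rho>(6)[of q] by (cases "f q = 0") (auto simp: d_def add_nonneg_eq_0_iff)
  moreover have "d \<in> smooth_functions A"
    unfolding d_def by (intro smooth_add smooth_mult smooth_diff smooth_const assms \<rho>)
  ultimately have "(\<lambda>q. f q * inverse (d q)) \<in> smooth_functions A"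
    by (intro smooth_mult smooth_inverse assms)
  then show thesis
    by (rule that[OF _ \<rho>(2,3)]) (use \<rho>(4,5) in \<open>auto simp: d_def subset_iff field_simps\<close>)
qed

section \<open>Tangent vectors and local frames\<close>

lemma tangentD:
  assumes "v \<in> tangent_space A p"
  shows tangent_add: "f \<in> smooth_functions A \<Longrightarrow> h \<in> smooth_functions A \<Longrightarrow> v (\<lambda>x. f x + h x) = v f + v h"
    and tangent_mult: "f \<in> smooth_functions A \<Longrightarrow> h \<in> smooth_functions A \<Longrightarrow>
      v (\<lambda>x. f x * h x) = f p * v h + h p * v f"
    and tangent_cmult: "f \<in> smooth_functions A \<Longrightarrow> v (\<lambda>x. c * f x) = c * v f"
    and tangent_nonsmooth: "f \<notin> smooth_functions A \<Longrightarrow> v f = 0"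
  using assms by (auto simp: tangent_space_def)

lemma tangentI:
  assumes "\<And>f h. f \<in> smooth_functions A \<Longrightarrow> h \<in> smooth_functions A \<Longrightarrow> v (\<lambda>x. f x + h x) = v f + v h"
    and "\<And>f h. f \<in> smooth_functions A \<Longrightarrow> h \<in> smooth_functions A \<Longrightarrow>
      v (\<lambda>x. f x * h x) = f p * v h + h p * v f"
    and "\<And>c f. f \<in> smooth_functions A \<Longrightarrow> v (\<lambda>x. c * f x) = c * v f"
    and "\<And>f. f \<notin> smooth_functions A \<Longrightarrow> v f = 0"
  shows "v \<in> tangent_space A p"
  using assms by (simp add: tangent_space_def)

lemma tangent_const:
  assumes "v \<in> tangent_space A p"
  shows "v (\<lambda>x. c) = 0"
proof -
  \<comment> \<open>The product rule applied to \<open>1 * 1\<close>.\<close>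
  have "v (\<lambda>x. 1) = 0" using tangent_mult[OF assms smooth_const smooth_const, of 1 1] by simp
  then show ?thesis using tangent_cmult[OF assms smooth_const, of c 1] by simp
qed

lemma tangent_diff:
  assumes "v \<in> tangent_space A p" "f \<in> smooth_functions A" "h \<in> smooth_functions A"
  shows "v (\<lambda>x. f x - h x) = v f - v h"
  using tangent_add[OF assms(1,2), of "\<lambda>x. (-1) * h x"] tangent_cmult[OF assms(1,3), of "-1"]
    smooth_mult[OF smooth_const assms(3), of "-1"] by simp

lemma tangent_sum:
  assumes "v \<in> tangent_space A p" "\<And>i. i \<in> I \<Longrightarrow> f i \<in> smooth_functions A"
  shows "v (\<lambda>x. \<Sum>i\<in>I. f i x) = (\<Sum>i\<in>I. v (f i))"
  using assms(2)
proof (induction I rule: infinite_finite_induct)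
  case (insert i I)
  then show ?case using tangent_add[OF assms(1), of "f i" "\<lambda>x. \<Sum>i\<in>I. f i x"] by (auto simp: smooth_sum)
qed (auto simp: tangent_const[OF assms(1)])

text \<open>Multiplying \<open>f\<close> and \<open>h\<close> by a bump function supported in \<open>W\<close> makes them equal everywhere, and the
  product rule at \<open>p\<close>, where the bump function is 1 and \<open>f\<close> and \<open>h\<close> agree, compares the derivatives.\<close>

lemma tangent_local:
  assumes v: "v \<in> tangent_space A p" and f: "f \<in> smooth_functions A" and h: "h \<in> smooth_functions A"
    and W: "open W" "p \<in> W" "\<And>q. q \<in> W \<Longrightarrow> f q = h q"
  shows "v f = v h"
proof -
  obtain \<rho> V where \<rho>: "\<rho> \<in> smooth_functions A" "p \<in> V"
    "\<And>q. q \<in> V \<Longrightarrow> \<rho> q = 1" "\<And>q. q \<notin> W \<Longrightarrow> \<rho> q = 0"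
    by (rule bump[OF W(1,2)]) blast
  have "(\<lambda>x. \<rho> x * f x) = (\<lambda>x. \<rho> x * h x)"
    using W(3) \<rho>(4) by (metis mult_zero_left)
  then have "\<rho> p * v f + f p * v \<rho> = \<rho> p * v h + h p * v \<rho>"
    using tangent_mult[OF v \<rho>(1) f] tangent_mult[OF v \<rho>(1) h] by simp
  then show ?thesis using \<rho>(2,3) W(2,3) by simp
qed

lemma tangent_subspace: "subspace (tangent_space A p)"
proof (rule subspaceI)
  show "0 \<in> tangent_space A p" by (rule tangentI) auto
  show "v + w \<in> tangent_space A p" if "v \<in> tangent_space A p" "w \<in> tangent_space A p" for v w
    by (rule tangentI) (simp_all add: that[THEN tangent_add] that[THEN tangent_mult]
        that[THEN tangent_cmult] that[THEN tangent_nonsmooth] that[THEN tangent_const] algebra_simps)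
  show "c *\<^sub>R v \<in> tangent_space A p" if "v \<in> tangent_space A p" for c v
    by (rule tangentI) (simp_all add: scaleR_fun_def that[THEN tangent_add] that[THEN tangent_mult]
        that[THEN tangent_cmult] that[THEN tangent_nonsmooth] that[THEN tangent_const] algebra_simps)
qed

text \<open>Off \<open>K\<close> the product is 0 whatever values \<open>w\<close> has there, and the complement of \<open>K\<close> together with \<open>S\<close> is
  an open cover of the space.\<close>

lemma smooth_cutoff:
  fixes \<psi> w :: "'e \<Rightarrow> real"
  assumes "open S" "closed K" "K \<subseteq> S" "smooth_on UNIV \<psi>" "\<And>y. y \<notin> K \<Longrightarrow> \<psi> y = 0" "smooth_on S w"
  shows "smooth_on UNIV (\<lambda>y. \<psi> y * w y)"
  unfolding smooth_on_def
proof (intro allI Ck_on_local)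
  fix k and y :: 'e
  show "\<exists>T. open T \<and> y \<in> T \<and> Ck_on k T (\<lambda>y. \<psi> y * w y)"
  proof (cases "y \<in> S")
    case True
    have "Ck_on k S (\<lambda>y. \<psi> y * w y)"
      using assms(4,6) Ck_on_subset[of k UNIV \<psi> S]
      by (intro Ck_on_mult assms(1)) (auto simp: smooth_on_def)
    then show ?thesis using assms(1) True by blast
  next
    case False
    have "Ck_on k (- K) (\<lambda>y. \<psi> y * w y)"
      by (rule Ck_on_cong_imp[OF _ _ Ck_on_const[of _ _ 0]]) (use assms in auto)
    then show ?thesis using assms(2,3) False by blast
  qed
qed

text \<open>Globally defined functions \<open>x b\<close> and fields \<open>E b\<close> that behave on \<open>W\<close> as coordinates with
  their coordinate fields: dual to each other, and spanning every tangent space over \<open>W\<close>. They are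
  indexed by the standard basis of the model space.\<close>

definition frame_on :: "'a set \<Rightarrow> ('e \<Rightarrow> 'a \<Rightarrow> real) \<Rightarrow> ('e \<Rightarrow> 'a field) \<Rightarrow> bool"
  where "frame_on W x E \<longleftrightarrow>
    (\<forall>b. x b \<in> smooth_functions A \<and> E b \<in> vector_fields A) \<and>
    (\<forall>q\<in>W. (\<forall>b\<in>Basis. \<forall>c\<in>Basis. E b q (x c) = (if b = c then 1 else 0)) \<and>
      (\<forall>v\<in>tangent_space A q. v = (\<Sum>b\<in>Basis. v (x b) *\<^sub>R E b q)))"

lemma frame_onD:
  assumes "frame_on W x E"
  shows "x b \<in> smooth_functions A" and "E b \<in> vector_fields A"
    and "q \<in> W \<Longrightarrow> b \<in> Basis \<Longrightarrow> c \<in> Basis \<Longrightarrow> E b q (x c) = (if b = c then 1 else 0)"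
    and "q \<in> W \<Longrightarrow> v \<in> tangent_space A q \<Longrightarrow> v = (\<Sum>b\<in>Basis. v (x b) *\<^sub>R E b q)"
  using assms unfolding frame_on_def by blast+

text \<open>The \<open>x b\<close> are the coordinates of a chart and the \<open>E b\<close> its partial derivatives, both cut
  off to become global. That they span is Hadamard's lemma: near \<open>q\<close> a smooth function is
  \<open>f q + (\<Sum>b. (x b - x b q) * H b)\<close>, and a derivation at \<open>q\<close> sees only \<open>H b q\<close>, the partial derivative
  of \<open>f\<close>.\<close>

lemma local_frame:
  obtains W x E where "open W" "p \<in> W" "frame_on W x E"
proof -
  obtain U \<phi> where c: "(U, \<phi>) \<in> A" "p \<in> U" by (rule chart_at)
  let ?\<kappa> = "inv_into U \<phi>"
  obtain t where t: "t > 0" "cball (\<phi> p) t \<subseteq> \<phi> ` U"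
    using c chart_image[OF c(1)] open_contains_cball by blast
  \<comment> \<open>The cut-off is 1 on \<open>B\<close> and 0 off the compact \<open>K\<close>; Hadamard's lemma is applied on the convex \<open>S\<close>.\<close>
  define S where "S = ball (\<phi> p) t"
  define K where "K = cball (\<phi> p) (t / 2)"
  define B where "B = ball (\<phi> p) (t / 4)"
  have S: "open S" "convex S" "S \<subseteq> \<phi> ` U" and K: "compact K" "closed K" "K \<subseteq> S" "K \<subseteq> \<phi> ` U"
    and B: "open B" "B \<subseteq> K"
    using t by (auto simp: S_def K_def B_def subset_iff)
  obtain \<psi> :: "'e \<Rightarrow> real" where \<psi>0: "smooth_on UNIV \<psi>"
      "\<And>y. dist (\<phi> p) y \<le> t / 4 \<Longrightarrow> \<psi> y = 1" "\<And>y. t / 2 \<le> dist (\<phi> p) y \<Longrightarrow> \<psi> y = 0"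
    using euclidean_bump[of "t / 4" "t / 2" "\<phi> p"] t by auto
  then have \<psi>: "smooth_on UNIV \<psi>" "\<And>y. y \<in> B \<Longrightarrow> \<psi> y = 1" "\<And>y. y \<notin> K \<Longrightarrow> \<psi> y = 0"
    by (auto simp: B_def K_def)
  have ext: "(\<lambda>q. if q \<in> U then \<psi> (\<phi> q) * w (\<phi> q) else 0) \<in> smooth_functions A"
    if "smooth_on S w" for w
    using smooth_extend_by_zero[OF c(1) K(1,4) smooth_cutoff[OF S(1) K(2,3) \<psi>(1,3) that]] \<psi>(3) by simp
  define W where "W = U \<inter> \<phi> -` B"
  define x where "x = (\<lambda>b q. if q \<in> U then \<psi> (\<phi> q) * (\<phi> q \<bullet> b) else 0)"
  define E where "E = (\<lambda>b q f. if q \<in> U \<and> f \<in> smooth_functions A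
      then \<psi> (\<phi> q) * frechet_derivative (f \<circ> ?\<kappa>) (at (\<phi> q)) b else 0)"
  have W: "open W" "p \<in> W" "W \<subseteq> U"
    using chart_open_preimage[OF c(1) B(1)] c t by (auto simp: W_def B_def)
  have x: "x b \<in> smooth_functions A" for b
    unfolding x_def
    by (rule ext) (simp add: smooth_on_def Ck_on_bounded_linear bounded_linear_inner_left)
  have D: "((f \<circ> ?\<kappa>) has_derivative frechet_derivative (f \<circ> ?\<kappa>) (at (\<phi> q))) (at (\<phi> q))"
    if "f \<in> smooth_functions A" "q \<in> U" for f q
    using smooth_on_has_derivative[OF smooth_functionsD[OF that(1) c(1)]] that(2) by blast
  have E: "E b \<in> vector_fields A" for b
    unfolding smooth_sections_def
  proof (intro CollectI conjI allI ballI)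
    fix q
    show "E b q \<in> tangent_space A q"
    proof (cases "q \<in> U")
      case True
      have "E b q (\<lambda>x. f x + h x) = E b q f + E b q h \<and>
          E b q (\<lambda>x. f x * h x) = f q * E b q h + h q * E b q f"
        if f: "f \<in> smooth_functions A" and h: "h \<in> smooth_functions A" for f h
      proof -
        have "frechet_derivative (\<lambda>y. f (?\<kappa> y) + h (?\<kappa> y)) (at (\<phi> q)) =
          (\<lambda>v. frechet_derivative (\<lambda>y. f (?\<kappa> y)) (at (\<phi> q)) v + frechet_derivative (\<lambda>y. h (?\<kappa> y)) (at (\<phi> q)) v)"
          using frechet_derivative_at[OF has_derivative_add[OF D[OF f True] D[OF h True]]]
          by (simp add: o_def)
        moreover have "frechet_derivative (\<lambda>y. f (?\<kappa> y) * h (?\<kappa> y)) (at (\<phi> q)) =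
          (\<lambda>v. f q * frechet_derivative (\<lambda>y. h (?\<kappa> y)) (at (\<phi> q)) v + frechet_derivative (\<lambda>y. f (?\<kappa> y)) (at (\<phi> q)) v * h q)"
          using frechet_derivative_at[OF has_derivative_mult[OF D[OF f True] D[OF h True]]] c True
          by (simp add: o_def)
        ultimately show ?thesis
          using f h True smooth_add[OF f h] smooth_mult[OF f h] by (simp add: E_def o_def algebra_simps)
      qed
      moreover have "E b q (\<lambda>x. k * f x) = k * E b q f" if f: "f \<in> smooth_functions A" for k f
      proof -
        have "frechet_derivative (\<lambda>y. k * f (?\<kappa> y)) (at (\<phi> q)) =
          (\<lambda>v. k * frechet_derivative (\<lambda>y. f (?\<kappa> y)) (at (\<phi> q)) v)"
          using frechet_derivative_at[OF has_derivative_mult_right[OF D[OF f True], of k]]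
          by (simp add: o_def)
        then show ?thesis
          using f True smooth_mult[OF smooth_const f] by (simp add: E_def o_def)
      qed
      ultimately show ?thesis by (simp add: tangent_space_def E_def)
    qed (simp add: tangent_space_def E_def)
  next
    fix f assume f: "f \<in> smooth_functions A"
    have "smooth_on S (\<lambda>y. frechet_derivative (f \<circ> ?\<kappa>) (at y) b)"
      using smooth_on_frechet_derivative[OF smooth_functionsD[OF f c(1)]] S(3) Ck_on_subset
      unfolding smooth_on_def by blast
    from ext[OF this] show "(\<lambda>q. E b q f) \<in> smooth_functions A" using f by (simp add: E_def)
  qed
  have dual: "E b q (x a) = (if b = a then 1 else 0)"
    if q: "q \<in> W" and "b \<in> Basis" "a \<in> Basis" for q b a
  proof -
    have "((\<lambda>y. y \<bullet> a) has_derivative (\<lambda>y. y \<bullet> a)) (at (\<phi> q))"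
      by (auto intro!: derivative_eq_intros)
    then have "((x a \<circ> ?\<kappa>) has_derivative (\<lambda>y. y \<bullet> a)) (at (\<phi> q))"
    proof (rule has_derivative_transform_within_open[OF _ B(1)])
      show "y \<bullet> a = (x a \<circ> ?\<kappa>) y" if "y \<in> B" for y
      proof -
        have "y \<in> \<phi> ` U" using that B K by blast
        then show ?thesis using \<psi>(2)[OF that] c by (auto simp: x_def)
      qed
    qed (use q in \<open>simp add: W_def\<close>)
    then have "E b q (x a) = b \<bullet> a"
      using q x \<psi>(2) frechet_derivative_at[of "x a \<circ> ?\<kappa>", symmetric] by (simp add: E_def W_def)
    then show ?thesis using that by (simp add: inner_Basis)
  qed
  have repr: "v f = (\<Sum>b\<in>Basis. v (x b) * E b q f)"
    if q: "q \<in> W" and v: "v \<in> tangent_space A q" for q v f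
  proof (cases "f \<in> smooth_functions A")
    case False
    then show ?thesis using tangent_nonsmooth[OF v] by (simp add: E_def)
  next
    case f: True
    have qS: "\<phi> q \<in> S" "q \<in> U" using q B K by (auto simp: W_def)
    have sf: "smooth_on S (f \<circ> ?\<kappa>)"
      using smooth_functionsD[OF f c(1)] S(3) Ck_on_subset unfolding smooth_on_def by blast
    obtain h where h: "\<And>b. smooth_on S (h b)"
      "\<And>y. y \<in> S \<Longrightarrow> (f \<circ> ?\<kappa>) y = (f \<circ> ?\<kappa>) (\<phi> q) + (\<Sum>b\<in>Basis. ((y - \<phi> q) \<bullet> b) * h b y)"
      "\<And>b. h b (\<phi> q) = frechet_derivative (f \<circ> ?\<kappa>) (at (\<phi> q)) b"
      by (rule hadamard[OF S(1,2) qS(1) sf]) blast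
    define H where "H = (\<lambda>b q. if q \<in> U then \<psi> (\<phi> q) * h b (\<phi> q) else 0)"
    have H: "H b \<in> smooth_functions A" for b
      unfolding H_def by (rule ext[OF h(1)])
    have sm: "(\<lambda>r. (x b r - x b q) * H b r) \<in> smooth_functions A" for b
      by (intro smooth_mult smooth_diff smooth_const x H)
    have "f r = f q + (\<Sum>b\<in>Basis. (x b r - x b q) * H b r)" if r: "r \<in> W" for r
    proof -
      have "\<phi> r \<in> S" "r \<in> U" "\<psi> (\<phi> r) = 1" "\<psi> (\<phi> q) = 1"
        using r q B K \<psi>(2) by (auto simp: W_def)
      then show ?thesis
        using h(2)[of "\<phi> r"] c qS by (simp add: x_def H_def inner_diff_left)
    qed
    then have "v f = v (\<lambda>r. f q + (\<Sum>b\<in>Basis. (x b r - x b q) * H b r))"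
      by (intro tangent_local[OF v f _ W(1) q] smooth_add smooth_const smooth_sum sm)
    also have "\<dots> = (\<Sum>b\<in>Basis. v (\<lambda>r. (x b r - x b q) * H b r))"
      using tangent_add[OF v smooth_const[of "f q"] smooth_sum[where I = Basis, OF sm, of "\<lambda>b. b"]]
        tangent_sum[OF v sm, of "\<lambda>b. b" Basis]
      by (simp add: tangent_const[OF v])
    also have "\<dots> = (\<Sum>b\<in>Basis. v (x b) * E b q f)"
    proof (rule sum.cong[OF refl])
      fix b :: 'e
      have "v (\<lambda>r. (x b r - x b q) * H b r) = H b q * v (\<lambda>r. x b r - x b q)"
        using tangent_mult[OF v smooth_diff[OF x smooth_const] H] by simp
      also have "\<dots> = H b q * v (x b)"
        using tangent_diff[OF v x smooth_const] tangent_const[OF v] by simp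
      also have "H b q = E b q f"
        using qS f h(3) by (simp add: H_def E_def)
      finally show "v (\<lambda>r. (x b r - x b q) * H b r) = v (x b) * E b q f" by simp
    qed
    finally show ?thesis .
  qed
  have "v = (\<Sum>b\<in>Basis. v (x b) *\<^sub>R E b q)" if "q \<in> W" "v \<in> tangent_space A q" for q v
  proof
    show "v f = (\<Sum>b\<in>Basis. v (x b) *\<^sub>R E b q) f" for f
      using repr[OF that, of f] by (simp add: sum_tangent_apply scaleR_fun_def)
  qed
  then have "frame_on W x E"
    using x E dual unfolding frame_on_def by (intro conjI allI ballI) simp_all
  with W show thesis by (intro that)
qed

end

section \<open>Linear systems with smooth coefficients\<close>

text \<open>The standard basis as a finite type, which makes square matrices over it, their determinants and
  Cramer's rule available in the dimension of an arbitrary model space.\<close>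

typedef (overloaded) ('e::euclidean_space) basis_index = "Basis :: 'e set"
  using nonempty_Basis by blast

lemma bij_Rep_basis_index: "bij_betw Rep_basis_index UNIV (Basis :: 'e::euclidean_space set)"
  by (rule bij_betwI[where g = Abs_basis_index])
    (auto simp: Rep_basis_index Rep_basis_index_inverse Abs_basis_index_inverse)

instance basis_index :: (euclidean_space) finite
  by standard (use bij_betw_finite[OF bij_Rep_basis_index] in simp)

lemma sum_Basis_index:
  "(\<Sum>b\<in>(Basis :: 'e::euclidean_space set). f b) = (\<Sum>i\<in>UNIV. f (Rep_basis_index i))"
  by (rule sum.reindex_bij_betw[OF bij_Rep_basis_index, symmetric])

context smooth_manifold
begin

lemma smooth_det:
  fixes N :: "'a \<Rightarrow> real ^ 'n ^ 'n"
  assumes "\<And>i j. (\<lambda>q. N q $ i $ j) \<in> smooth_functions A"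
  shows "(\<lambda>q. det (N q)) \<in> smooth_functions A"
  unfolding det_def by (intro smooth_sum smooth_mult smooth_prod smooth_const assms)

text \<open>Injectivity at the single point \<open>p\<close> suffices: the determinant is smooth and nonzero at \<open>p\<close>,
  hence nonzero nearby, and Cramer's rule expresses the solution by determinants.\<close>

lemma smooth_linear_system:
  fixes G :: "'e \<Rightarrow> 'e \<Rightarrow> 'a \<Rightarrow> real"
  assumes G: "\<And>b c. G b c \<in> smooth_functions A" and \<beta>: "\<And>b. \<beta> b \<in> smooth_functions A"
    and inj: "\<And>a. (\<And>b. b \<in> Basis \<Longrightarrow> (\<Sum>c\<in>Basis. G b c p * a c) = 0) \<Longrightarrow> \<forall>c\<in>Basis. a c = 0"
  obtains W a where "open W" "p \<in> W" "\<And>c. a c \<in> smooth_functions A"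
    "\<And>q b. q \<in> W \<Longrightarrow> b \<in> Basis \<Longrightarrow> (\<Sum>c\<in>Basis. G b c q * a c q) = \<beta> b q"
proof -
  let ?R = "Rep_basis_index :: 'e basis_index \<Rightarrow> 'e" and ?A = "Abs_basis_index :: 'e \<Rightarrow> 'e basis_index"
  define M :: "'a \<Rightarrow> real ^ 'e basis_index ^ 'e basis_index" where "M = (\<lambda>q. \<chi> i j. G (?R i) (?R j) q)"
  have M: "(M q *v x) $ i = (\<Sum>j\<in>UNIV. G (?R i) (?R j) q * x $ j)" for q x i
    by (simp add: M_def matrix_vector_mult_def)
  have "x = 0" if x: "M p *v x = 0" for x
  proof -
    have "(\<Sum>c\<in>Basis. G b c p * x $ ?A c) = 0" if "b \<in> Basis" for b
    proof -
      have "(M p *v x) $ ?A b = 0" using x by simp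
      then show ?thesis using that
        by (simp add: M sum_Basis_index Rep_basis_index_inverse Abs_basis_index_inverse)
    qed
    from inj[OF this] have "x $ ?A (?R i) = 0" for i
      using Rep_basis_index by blast
    then show ?thesis by (simp add: vec_eq_iff Rep_basis_index_inverse)
  qed
  then have det: "det (M p) \<noteq> 0"
    using matrix_left_invertible_ker[of "M p"] invertible_left_inverse invertible_det_nz by blast
  have Ms: "(\<lambda>q. M q $ i $ j) \<in> smooth_functions A" for i j
    by (simp add: M_def G)
  obtain h W where h: "h \<in> smooth_functions A" "open W" "p \<in> W" "\<And>q. q \<in> W \<Longrightarrow> h q * det (M q) = 1"
    by (rule local_reciprocal[OF smooth_det[OF Ms] det]) blast
  \<comment> \<open>Cramer's matrices: column \<open>k\<close> replaced by the right-hand side.\<close>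
  define N where "N = (\<lambda>k q. \<chi> i j. if j = k then \<beta> (?R i) q else M q $ i $ j)"
  have N: "(\<lambda>q. det (N k q)) \<in> smooth_functions A" for k
  proof (rule smooth_det)
    show "(\<lambda>q. N k q $ i $ j) \<in> smooth_functions A" for i j
      by (cases "j = k") (simp_all add: N_def Ms \<beta>)
  qed
  show thesis
  proof (rule that[OF h(2,3)])
    show "(\<lambda>q. h q * det (N (?A c) q)) \<in> smooth_functions A" for c
      by (intro smooth_mult h N)
    fix q and b :: 'e assume q: "q \<in> W" and b: "b \<in> Basis"
    have d: "det (M q) \<noteq> 0" "h q = 1 / det (M q)"
      using h(4)[OF q] by (auto simp: eq_divide_eq)
    have "M q *v (\<chi> k. h q * det (N k q)) = (\<chi> i. \<beta> (?R i) q)"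
      unfolding cramer[OF d(1)] by (auto simp: N_def d(2) vec_eq_iff cong: if_cong intro!: arg_cong[where f = det])
    then have "(M q *v (\<chi> k. h q * det (N k q))) $ ?A b = \<beta> b q"
      using b by (simp add: Abs_basis_index_inverse)
    then show "(\<Sum>c\<in>Basis. G b c q * (h q * det (N (?A c) q))) = \<beta> b q"
      using b by (simp add: M sum_Basis_index Rep_basis_index_inverse Abs_basis_index_inverse)
  qed
qed

section \<open>Vector fields and Lie brackets\<close>

lemma field_tangent: "X \<in> vector_fields A \<Longrightarrow> X p \<in> tangent_space A p"
  by (simp add: smooth_sections_def)

lemma field_smooth: "X \<in> vector_fields A \<Longrightarrow> f \<in> smooth_functions A \<Longrightarrow> (\<lambda>p. X p f) \<in> smooth_functions A"
  by (simp add: smooth_sections_def)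

lemma field_nonsmooth: "X \<in> vector_fields A \<Longrightarrow> f \<notin> smooth_functions A \<Longrightarrow> X p f = 0"
  using tangent_nonsmooth field_tangent by blast

lemma fieldI:
  "(\<And>p. X p \<in> tangent_space A p) \<Longrightarrow> (\<And>f. f \<in> smooth_functions A \<Longrightarrow> (\<lambda>p. X p f) \<in> smooth_functions A)
    \<Longrightarrow> X \<in> vector_fields A"
  by (simp add: smooth_sections_def)

lemma field_add: "X \<in> vector_fields A \<Longrightarrow> Y \<in> vector_fields A \<Longrightarrow> X + Y \<in> vector_fields A"
  by (rule fieldI) (simp_all add: subspace_add[OF tangent_subspace] field_tangent smooth_add field_smooth)

lemma field_fun_scale:
  "f \<in> smooth_functions A \<Longrightarrow> X \<in> vector_fields A \<Longrightarrow> fun_scale f X \<in> vector_fields A"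
proof (rule fieldI)
  assume f: "f \<in> smooth_functions A" and X: "X \<in> vector_fields A"
  show "fun_scale f X p \<in> tangent_space A p" for p
    by (simp add: fun_scale_apply subspace_scale[OF tangent_subspace] field_tangent X)
  show "(\<lambda>p. fun_scale f X p h) \<in> smooth_functions A" if "h \<in> smooth_functions A" for h
    using smooth_mult[OF f field_smooth[OF X that]] by (simp add: fun_scale_apply scaleR_fun_def)
qed

lemma scaleR_eq_fun_scale: "c *\<^sub>R X = fun_scale (\<lambda>p. c) X"
  by (simp add: fun_scale_def scaleR_fun_def)

lemma field_zero: "0 \<in> vector_fields A"
  by (rule fieldI) (simp_all add: subspace_0[OF tangent_subspace])

lemma field_sum: "(\<And>i. i \<in> I \<Longrightarrow> F i \<in> vector_fields A) \<Longrightarrow> (\<Sum>i\<in>I. F i) \<in> vector_fields A"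
  by (induction I rule: infinite_finite_induct) (auto simp: field_zero field_add)

lemma field_bracket:
  assumes X: "X \<in> vector_fields A" and Y: "Y \<in> vector_fields A"
  shows "lie_bracket X Y \<in> vector_fields A"
proof (rule fieldI)
  fix p
  note XD = tangentD[OF field_tangent[OF X]] and YD = tangentD[OF field_tangent[OF Y]]
  note Xs = field_smooth[OF X] and Ys = field_smooth[OF Y]
  show "lie_bracket X Y p \<in> tangent_space A p"
  proof (rule tangentI)
    fix f h assume f: "f \<in> smooth_functions A" and h: "h \<in> smooth_functions A"
    show "lie_bracket X Y p (\<lambda>x. f x + h x) = lie_bracket X Y p f + lie_bracket X Y p h"
      by (simp add: lie_bracket_def XD(1) YD(1) Xs Ys f h)
    show "lie_bracket X Y p (\<lambda>x. f x * h x) = f p * lie_bracket X Y p h + h p * lie_bracket X Y p f"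
      by (simp add: lie_bracket_def XD(1,2) YD(1,2) Xs Ys f h smooth_mult algebra_simps)
  next
    fix c f assume f: "f \<in> smooth_functions A"
    show "lie_bracket X Y p (\<lambda>x. c * f x) = c * lie_bracket X Y p f"
      by (simp add: lie_bracket_def XD(3) YD(3) Xs Ys f algebra_simps)
  next
    fix f assume f: "f \<notin> smooth_functions A"
    show "lie_bracket X Y p f = 0"
      by (simp add: lie_bracket_def field_nonsmooth X Y f tangent_const[OF field_tangent])
  qed
next
  fix f assume f: "f \<in> smooth_functions A"
  show "(\<lambda>p. lie_bracket X Y p f) \<in> smooth_functions A"
    unfolding lie_bracket_def
    by (rule smooth_diff[OF field_smooth[OF X field_smooth[OF Y f]] field_smooth[OF Y field_smooth[OF X f]]])
qed

lemma bracket_swap: "lie_bracket Y X p = (-1) *\<^sub>R lie_bracket X Y p"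
  by (simp add: lie_bracket_def scaleR_fun_def fun_eq_iff)

lemma bracket_add_right:
  assumes X: "X \<in> vector_fields A" and Y: "Y \<in> vector_fields A" and Z: "Z \<in> vector_fields A"
  shows "lie_bracket X (Y + Z) p = lie_bracket X Y p + lie_bracket X Z p"
proof
  fix f
  show "lie_bracket X (Y + Z) p f = (lie_bracket X Y p + lie_bracket X Z p) f"
  proof (cases "f \<in> smooth_functions A")
    case True
    then show ?thesis
      by (simp add: lie_bracket_def tangent_add[OF field_tangent[OF X]] field_smooth Y Z)
  next
    case False
    then show ?thesis
      by (simp add: lie_bracket_def field_nonsmooth X Y Z tangent_const[OF field_tangent[OF X]])
  qed
qed

lemma bracket_fun_scale_right:
  assumes X: "X \<in> vector_fields A" and Y: "Y \<in> vector_fields A" and f: "f \<in> smooth_functions A"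
  shows "lie_bracket X (fun_scale f Y) p = X p f *\<^sub>R Y p + f p *\<^sub>R lie_bracket X Y p"
proof
  fix h
  show "lie_bracket X (fun_scale f Y) p h = (X p f *\<^sub>R Y p + f p *\<^sub>R lie_bracket X Y p) h"
  proof (cases "h \<in> smooth_functions A")
    case True
    then show ?thesis
      by (simp add: lie_bracket_def fun_scale_apply scaleR_fun_def
          tangent_mult[OF field_tangent[OF X] f] field_smooth Y algebra_simps)
  next
    case False
    then show ?thesis
      by (simp add: lie_bracket_def fun_scale_apply scaleR_fun_def field_nonsmooth X Y
          tangent_const[OF field_tangent[OF X]])
  qed
qed

lemma tangent_extends:
  assumes "v \<in> tangent_space A p"
  obtains V where "V \<in> vector_fields A" "V p = v"
proof -
  obtain W x E where W: "p \<in> W" and F: "frame_on W x E"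
    by (rule local_frame[of p]) blast
  show thesis
  proof
    show "(\<Sum>b\<in>Basis. fun_scale (\<lambda>q. v (x b)) (E b)) \<in> vector_fields A"
      by (intro field_sum field_fun_scale smooth_const frame_onD(2)[OF F])
    show "(\<Sum>b\<in>Basis. fun_scale (\<lambda>q. v (x b)) (E b)) p = v"
      using frame_onD(4)[OF F W assms] by (simp add: sum_field_apply fun_scale_apply)
  qed
qed

end

section \<open>The Koszul expression of a degenerate metric\<close>

locale lightlike_data = smooth_manifold A
  for A :: "('a::{t2_space,second_countable_topology}, 'e::euclidean_space) chart set" +
  fixes g :: "'a bilinear_field" and \<xi> :: "'a field" and \<tau> :: "'a form"
  assumes g_tensor: "smooth_symmetric_tensor A g"
    and radical_dim: "\<And>p. dim (radical_space A g p) = 1"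
    and xi_radical: "\<xi> \<in> smooth_sections A (radical_space A g)"
    and xi_nonzero: "\<And>p. \<xi> p \<noteq> 0"
    and xi_Killing: "\<And>Y Z p. Y \<in> vector_fields A \<Longrightarrow> Z \<in> vector_fields A \<Longrightarrow> lie_derivative \<xi> g Y Z p = 0"
    and tau_closed: "closed_one_form A \<tau>"
    and tau_xi: "\<And>p. \<tau> p (\<xi> p) = 1"
begin

abbreviation fields ("\<XX>") where "\<XX> \<equiv> vector_fields A"
abbreviation smooths ("\<CC>") where "\<CC> \<equiv> smooth_functions A"
abbreviation tangent ("\<TT>") where "\<TT> p \<equiv> tangent_space A p"

lemma g_linear: "v \<in> \<TT> p \<Longrightarrow> linear_form_on (\<TT> p) (g p v)"
  and g_sym: "v \<in> \<TT> p \<Longrightarrow> w \<in> \<TT> p \<Longrightarrow> g p v w = g p w v"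
  and g_smooth: "X \<in> \<XX> \<Longrightarrow> Y \<in> \<XX> \<Longrightarrow> (\<lambda>p. g p (X p) (Y p)) \<in> \<CC>"
  using g_tensor unfolding smooth_symmetric_tensor_def by blast+

lemma tau_linear: "linear_form_on (\<TT> p) (\<tau> p)"
  and tau_smooth: "X \<in> \<XX> \<Longrightarrow> (\<lambda>p. \<tau> p (X p)) \<in> \<CC>"
  and tau_bracket: "X \<in> \<XX> \<Longrightarrow> Y \<in> \<XX> \<Longrightarrow>
    \<tau> p (lie_bracket X Y p) = X p (\<lambda>q. \<tau> q (Y q)) - Y p (\<lambda>q. \<tau> q (X q))"
  using tau_closed unfolding closed_one_form_def smooth_one_form_def by (blast | force)+

lemma g_right:
  assumes "v \<in> \<TT> p" "w \<in> \<TT> p"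
  shows "w' \<in> \<TT> p \<Longrightarrow> g p v (w + w') = g p v w + g p v w'"
    and "g p v (c *\<^sub>R w) = c * g p v w"
  using g_linear[OF assms(1)] assms(2) unfolding linear_form_on_def by blast+

lemma g_left:
  assumes "v \<in> \<TT> p" "w \<in> \<TT> p"
  shows "v' \<in> \<TT> p \<Longrightarrow> g p (v + v') w = g p v w + g p v' w"
    and g_scale_left: "g p (c *\<^sub>R v) w = c * g p v w"
  using assms by (simp_all add: g_sym[of _ p w] g_right subspace_add[OF tangent_subspace]
      subspace_scale[OF tangent_subspace])

lemma tau_add: "v \<in> \<TT> p \<Longrightarrow> w \<in> \<TT> p \<Longrightarrow> \<tau> p (v + w) = \<tau> p v + \<tau> p w"
  and tau_scale: "v \<in> \<TT> p \<Longrightarrow> \<tau> p (c *\<^sub>R v) = c * \<tau> p v"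
  using tau_linear unfolding linear_form_on_def by blast+

lemma xi_field: "\<xi> \<in> \<XX>"
  using xi_radical by (auto simp: smooth_sections_def radical_space_def)

lemma g_xi: "v \<in> \<TT> p \<Longrightarrow> g p (\<xi> p) v = 0" "v \<in> \<TT> p \<Longrightarrow> g p v (\<xi> p) = 0"
proof -
  assume v: "v \<in> \<TT> p"
  have "\<xi> p \<in> radical_space A g p" using xi_radical by (simp add: smooth_sections_def)
  then show "g p (\<xi> p) v = 0" using v by (simp add: radical_space_def)
  then show "g p v (\<xi> p) = 0" using g_sym[OF v field_tangent[OF xi_field]] by simp
qed

lemma radical_eq_multiples:
  assumes "v \<in> radical_space A g p"
  obtains c where "v = c *\<^sub>R \<xi> p"
proof -
  obtain B where B: "radical_space A g p \<subseteq> span B" "card B = 1"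
    using basis_exists[of "radical_space A g p"] radical_dim by metis
  then obtain e where e: "B = {e}" using card_1_singletonE by blast
  have "\<xi> p \<in> radical_space A g p" using xi_radical by (simp add: smooth_sections_def)
  then have "\<xi> p \<in> range (\<lambda>k. k *\<^sub>R e)" "v \<in> range (\<lambda>k. k *\<^sub>R e)"
    using B(1) assms e by (auto simp: span_singleton)
  then obtain a b where ab: "\<xi> p = a *\<^sub>R e" "v = b *\<^sub>R e"
    by blast
  have "a \<noteq> 0" using xi_nonzero[of p] ab by auto
  then have "v = (b / a) *\<^sub>R \<xi> p" using ab by simp
  then show thesis by (rule that)
qed

text \<open>What \<open>g\<close> does not see is a multiple of \<open>\<xi>\<close>, and \<open>\<tau>\<close> reads off the factor. So \<open>g\<close> and \<open>\<tau>\<close> together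
  determine a tangent vector.\<close>

lemma nondegenerate:
  assumes "v \<in> \<TT> p" "\<And>w. w \<in> \<TT> p \<Longrightarrow> g p v w = 0" "\<tau> p v = 0"
  shows "v = 0"
proof -
  have "v \<in> radical_space A g p" using assms by (simp add: radical_space_def)
  then obtain c where c: "v = c *\<^sub>R \<xi> p" by (rule radical_eq_multiples)
  then have "c = 0" using assms(3) tau_scale[OF field_tangent[OF xi_field]] tau_xi by simp
  then show ?thesis using c by simp
qed

text \<open>The right-hand side of the Koszul formula for \<open>g (\<nabla>\<^sub>X Y) Z\<close>. It makes sense for degenerate \<open>g\<close>,
  only that no \<open>\<nabla>\<^sub>X Y\<close> need exist.\<close>

definition koszul :: "'a field \<Rightarrow> 'a field \<Rightarrow> 'a field \<Rightarrow> 'a \<Rightarrow> real"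
  where "koszul X Y Z p = (1 / 2) *
    (X p (\<lambda>q. g q (Y q) (Z q)) + Y p (\<lambda>q. g q (X q) (Z q)) - Z p (\<lambda>q. g q (X q) (Y q))
      + g p (lie_bracket X Y p) (Z p) - g p (lie_bracket X Z p) (Y p) - g p (lie_bracket Y Z p) (X p))"

lemma g_bracket_swap:
  assumes "X \<in> \<XX>" "Y \<in> \<XX>" "v \<in> \<TT> p"
  shows "g p (lie_bracket Y X p) v = - g p (lie_bracket X Y p) v"
proof -
  have "lie_bracket Y X p = (-1) *\<^sub>R lie_bracket X Y p"
    by (simp add: bracket_swap[of Y X] scaleR_fun_def)
  then show ?thesis using g_scale_left[OF field_tangent[OF field_bracket[OF assms(1,2)]] assms(3), of "-1"]
    by simp
qed

lemma g_bracket_right: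
  assumes "X \<in> \<XX>" "Y \<in> \<XX>" "v \<in> \<TT> p"
  shows "Y' \<in> \<XX> \<Longrightarrow>
      g p (lie_bracket X (Y + Y') p) v = g p (lie_bracket X Y p) v + g p (lie_bracket X Y' p) v"
    and "f \<in> \<CC> \<Longrightarrow>
      g p (lie_bracket X (fun_scale f Y) p) v = f p * g p (lie_bracket X Y p) v + X p f * g p (Y p) v"
  using assms
  by (simp_all add: bracket_add_right bracket_fun_scale_right g_left field_tangent field_bracket
      subspace_scale[OF tangent_subspace])

lemma g_bracket_left:
  assumes "X \<in> \<XX>" "Y \<in> \<XX>" "v \<in> \<TT> p"
  shows "Y' \<in> \<XX> \<Longrightarrow>
      g p (lie_bracket (Y + Y') X p) v = g p (lie_bracket Y X p) v + g p (lie_bracket Y' X p) v"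
    and "f \<in> \<CC> \<Longrightarrow>
      g p (lie_bracket (fun_scale f Y) X p) v = f p * g p (lie_bracket Y X p) v - X p f * g p (Y p) v"
  using assms
  by (simp_all add: g_bracket_swap[of X _ v p] g_bracket_right field_add field_fun_scale)

text \<open>The transformation rules of the Koszul expression under sums and function multiples are pure
  computation: the derivatives of the factor \<open>f\<close> cancel by the symmetry of \<open>g\<close> in the first and third
  argument, and one of them survives in the second, as it must for a connection.\<close>

lemmas derivation_rules = tangent_add[OF field_tangent] tangent_mult[OF field_tangent]

lemmas koszul_rules = koszul_def fun_scale_apply g_bracket_right g_bracket_left
  g_right g_left g_smooth field_tangent field_bracket

lemma koszul_add_3:
  assumes X: "X \<in> \<XX>" and Y: "Y \<in> \<XX>" and Z: "Z \<in> \<XX>" and Z': "Z' \<in> \<XX>"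
  shows "koszul X Y (Z + Z') p = koszul X Y Z p + koszul X Y Z' p"
  using assms g_sym[of "X p" p "Z p"] g_sym[of "Y p" p "Z p"] g_sym[of "X p" p "Y p"]
  by (simp add: koszul_rules
      derivation_rules[OF X] derivation_rules[OF Y] derivation_rules[OF Z] derivation_rules[OF Z'] algebra_simps)

lemma koszul_scale_3:
  assumes X: "X \<in> \<XX>" and Y: "Y \<in> \<XX>" and Z: "Z \<in> \<XX>" and "f \<in> \<CC>"
  shows "koszul X Y (fun_scale f Z) p = f p * koszul X Y Z p"
  using assms g_sym[of "X p" p "Z p"] g_sym[of "Y p" p "Z p"] g_sym[of "X p" p "Y p"]
  by (simp add: koszul_rules scaleR_fun_apply
      derivation_rules[OF X] derivation_rules[OF Y] derivation_rules[OF Z] algebra_simps)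

lemma koszul_add_1:
  assumes X: "X \<in> \<XX>" and Y: "Y \<in> \<XX>" and Z: "Z \<in> \<XX>" and X': "X' \<in> \<XX>"
  shows "koszul (X + X') Y Z p = koszul X Y Z p + koszul X' Y Z p"
  using assms g_sym[of "X p" p "Z p"] g_sym[of "Y p" p "Z p"] g_sym[of "X p" p "Y p"]
  by (simp add: koszul_rules
      derivation_rules[OF X] derivation_rules[OF Y] derivation_rules[OF Z] derivation_rules[OF X'] algebra_simps)

lemma koszul_scale_1:
  assumes X: "X \<in> \<XX>" and Y: "Y \<in> \<XX>" and Z: "Z \<in> \<XX>" and "f \<in> \<CC>"
  shows "koszul (fun_scale f X) Y Z p = f p * koszul X Y Z p"
  using assms g_sym[of "X p" p "Z p"] g_sym[of "Y p" p "Z p"] g_sym[of "X p" p "Y p"]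
  by (simp add: koszul_rules scaleR_fun_apply
      derivation_rules[OF X] derivation_rules[OF Y] derivation_rules[OF Z] algebra_simps)

lemma koszul_add_2:
  assumes X: "X \<in> \<XX>" and Y: "Y \<in> \<XX>" and Z: "Z \<in> \<XX>" and Y': "Y' \<in> \<XX>"
  shows "koszul X (Y + Y') Z p = koszul X Y Z p + koszul X Y' Z p"
  using assms g_sym[of "X p" p "Z p"] g_sym[of "Y p" p "Z p"] g_sym[of "X p" p "Y p"]
  by (simp add: koszul_rules
      derivation_rules[OF X] derivation_rules[OF Y] derivation_rules[OF Z] derivation_rules[OF Y'] algebra_simps)

lemma koszul_scale_2:
  assumes X: "X \<in> \<XX>" and Y: "Y \<in> \<XX>" and Z: "Z \<in> \<XX>" and "f \<in> \<CC>"
  shows "koszul X (fun_scale f Y) Z p = f p * koszul X Y Z p + X p f * g p (Y p) (Z p)"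
  using assms g_sym[of "X p" p "Z p"] g_sym[of "Y p" p "Z p"] g_sym[of "X p" p "Y p"]
  by (simp add: koszul_rules scaleR_fun_apply
      derivation_rules[OF X] derivation_rules[OF Y] derivation_rules[OF Z] algebra_simps)

lemma g_fields_commute:
  assumes "X \<in> \<XX>" "Y \<in> \<XX>"
  shows "(\<lambda>q. g q (X q) (Y q)) = (\<lambda>q. g q (Y q) (X q))"
  using assms g_sym field_tangent by blast

text \<open>The symmetric part in the last two arguments yields compatibility with \<open>g\<close>, the antisymmetric part
  in the first two yields vanishing torsion.\<close>

lemma koszul_swap_23:
  assumes X: "X \<in> \<XX>" and Y: "Y \<in> \<XX>" and Z: "Z \<in> \<XX>"
  shows "koszul X Y Z p + koszul X Z Y p = X p (\<lambda>q. g q (Y q) (Z q))"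
  using g_bracket_swap[OF Y Z field_tangent[OF X]] g_fields_commute[OF Z Y]
  by (simp add: koszul_def algebra_simps)

lemma koszul_swap_12:
  assumes X: "X \<in> \<XX>" and Y: "Y \<in> \<XX>" and Z: "Z \<in> \<XX>"
  shows "koszul X Y Z p - koszul Y X Z p = g p (lie_bracket X Y p) (Z p)"
  using g_bracket_swap[OF X Y field_tangent[OF Z]] g_fields_commute[OF Y X]
  by (simp add: koszul_def algebra_simps)

text \<open>This is the point where \<open>L\<^sub>\<xi> g = 0\<close> enters. A vector \<open>\<nabla>\<^sub>X Y\<close> satisfying the Koszul formula
  can exist only if the expression vanishes for \<open>Z = \<xi>\<close>, and for this \<open>Z\<close> the expression is
  \<open>- 1 / 2\<close> times the Lie derivative of \<open>g\<close> along \<open>\<xi>\<close>.\<close>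

lemma koszul_xi:
  assumes X: "X \<in> \<XX>" and Y: "Y \<in> \<XX>"
  shows "koszul X Y \<xi> p = 0"
proof -
  have z: "(\<lambda>q. g q (V q) (\<xi> q)) = (\<lambda>q. 0)" if "V \<in> \<XX>" for V
    using g_xi(2) field_tangent[OF that] by blast
  have "koszul X Y \<xi> p = - (1 / 2) * lie_derivative \<xi> g X Y p"
    using g_bracket_swap[OF xi_field X field_tangent[OF Y]] g_bracket_swap[OF xi_field Y field_tangent[OF X]]
      g_sym[OF field_tangent[OF X, of p] field_tangent[OF field_bracket[OF xi_field Y]]]
      g_xi(2)[OF field_tangent[OF field_bracket[OF X Y]]]
    by (simp add: koszul_def lie_derivative_def z X Y tangent_const[OF field_tangent] field_simps)
  then show ?thesis using xi_Killing[OF X Y] by simp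
qed

lemma koszul_smooth:
  assumes X: "X \<in> \<XX>" and Y: "Y \<in> \<XX>" and Z: "Z \<in> \<XX>"
  shows "koszul X Y Z \<in> \<CC>"
proof -
  have "(\<lambda>p. koszul X Y Z p) \<in> \<CC>"
    unfolding koszul_def
    by (intro smooth_mult smooth_add smooth_diff smooth_const
        field_smooth[OF X g_smooth[OF Y Z]] field_smooth[OF Y g_smooth[OF X Z]]
        field_smooth[OF Z g_smooth[OF X Y]] g_smooth[OF field_bracket[OF X Y] Z]
        g_smooth[OF field_bracket[OF X Z] Y] g_smooth[OF field_bracket[OF Y Z] X])
  then show ?thesis .
qed

lemma koszul_sum_3:
  assumes X: "X \<in> \<XX>" and Y: "Y \<in> \<XX>" and "\<And>i. i \<in> I \<Longrightarrow> F i \<in> \<XX>"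
  shows "koszul X Y (\<Sum>i\<in>I. F i) p = (\<Sum>i\<in>I. koszul X Y (F i) p)"
  using assms(3)
proof -
  have "koszul X Y (fun_scale (\<lambda>p. 0) X) p = 0"
    by (subst koszul_scale_3) (simp_all add: X Y)
  moreover have "fun_scale (\<lambda>p. 0) X = 0" by (simp add: fun_scale_def fun_eq_iff)
  ultimately have "koszul X Y 0 p = 0" by simp
  then show "(\<And>i. i \<in> I \<Longrightarrow> F i \<in> \<XX>) \<Longrightarrow> ?thesis"
    by (induction I rule: infinite_finite_induct) (simp_all add: koszul_add_3 X Y field_sum)
qed

text \<open>Although the frame spans only over \<open>W\<close>, tensoriality in \<open>Z\<close> is a statement about global fields. A
  bump function supported in \<open>W\<close> turns the frame expansion of \<open>Z\<close> into an identity of global fields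
  without changing anything at \<open>q\<close>.\<close>

lemma koszul_frame:
  assumes F: "frame_on W x E" "open W" "q \<in> W" and X: "X \<in> \<XX>" and Y: "Y \<in> \<XX>" and Z: "Z \<in> \<XX>"
  shows "koszul X Y Z q = (\<Sum>b\<in>Basis. Z q (x b) * koszul X Y (E b) q)"
proof -
  obtain \<rho> where \<rho>: "\<rho> \<in> \<CC>" "\<rho> q = 1" "\<And>r. r \<notin> W \<Longrightarrow> \<rho> r = 0"
    by (rule bump[OF F(2,3)]) blast
  note [simp] = frame_onD(1,2)[OF F(1)]
  have fs: "(\<lambda>r. \<rho> r * Z r (x b)) \<in> \<CC>" for b
    by (intro smooth_mult \<rho> field_smooth[OF Z] frame_onD(1)[OF F(1)])
  have eq: "fun_scale \<rho> Z = (\<Sum>b\<in>Basis. fun_scale (\<lambda>r. \<rho> r * Z r (x b)) (E b))"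
  proof
    fix r
    show "fun_scale \<rho> Z r = (\<Sum>b\<in>Basis. fun_scale (\<lambda>r. \<rho> r * Z r (x b)) (E b)) r"
    proof (cases "r \<in> W")
      case True
      have "Z r = (\<Sum>b\<in>Basis. Z r (x b) *\<^sub>R E b r)"
        by (rule frame_onD(4)[OF F(1) True field_tangent[OF Z]])
      then have "\<rho> r *\<^sub>R Z r = \<rho> r *\<^sub>R (\<Sum>b\<in>Basis. Z r (x b) *\<^sub>R E b r)"
        by simp
      then show ?thesis by (simp add: sum_field_apply fun_scale_apply scaleR_sum_right)
    next
      case False
      then show ?thesis by (simp add: sum_field_apply fun_scale_apply \<rho>(3))
    qed
  qed
  have "koszul X Y Z q = koszul X Y (fun_scale \<rho> Z) q"
    using koszul_scale_3[OF X Y Z \<rho>(1)] \<rho>(2) by simp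
  also have "\<dots> = (\<Sum>b\<in>Basis. Z q (x b) * koszul X Y (E b) q)"
    unfolding eq using \<rho>(2)
    by (simp add: koszul_sum_3 X Y field_fun_scale fs koszul_scale_3)
  finally show ?thesis .
qed

section \<open>The connection\<close>

text \<open>The conditions that compatibility with \<open>g\<close> and \<open>\<tau>\<close> and vanishing torsion impose on the value
  \<open>u\<close> of \<open>\<nabla>\<^sub>X Y\<close> at \<open>p\<close>.\<close>

definition solves :: "'a field \<Rightarrow> 'a field \<Rightarrow> 'a \<Rightarrow> 'a tangent_vector \<Rightarrow> bool"
  where "solves X Y p u \<longleftrightarrow> u \<in> \<TT> p \<and> \<tau> p u = X p (\<lambda>q. \<tau> q (Y q)) \<and>
    (\<forall>Z\<in>\<XX>. g p u (Z p) = koszul X Y Z p)"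

lemma solves_unique:
  assumes "solves X Y p u" "solves X Y p u'"
  shows "u = u'"
proof -
  have T: "u \<in> \<TT> p" "u' \<in> \<TT> p" using assms by (auto simp: solves_def)
  have "u - u' = 0"
  proof (rule nondegenerate)
    show "u - u' \<in> \<TT> p" using T by (simp add: subspace_diff[OF tangent_subspace])
    show "\<tau> p (u - u') = 0"
      using assms linear_form_on_diff[OF tau_linear tangent_subspace T] by (simp add: solves_def)
    fix w assume w: "w \<in> \<TT> p"
    then obtain Z where Z: "Z \<in> \<XX>" "Z p = w" by (rule tangent_extends)
    have "g p w (u - u') = g p w u - g p w u'"
      by (rule linear_form_on_diff[OF g_linear[OF w] tangent_subspace T])
    then have "g p (u - u') w = g p u w - g p u' w"
      using g_sym w T subspace_diff[OF tangent_subspace T] by metis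
    then show "g p (u - u') w = 0"
      using assms Z by (auto simp: solves_def)
  qed
  then show ?thesis by simp
qed

text \<open>The two conditions on \<open>u\<close> are merged into the single equation
  \<open>h u Z = koszul X Y Z + X (\<tau> Y) * \<tau> Z\<close> for the nondegenerate form \<open>h = g + \<tau> \<otimes> \<tau>\<close>. In a frame this is a
  linear system with smooth coefficients. Conversely, \<open>Z = \<xi>\<close> in the merged equation returns the
  condition on \<open>\<tau> u\<close>, since \<open>koszul X Y \<xi> = 0\<close>, and subtracting it returns the Koszul formula.\<close>

lemma local_solution:
  assumes X: "X \<in> \<XX>" and Y: "Y \<in> \<XX>"
  obtains W S where "open W" "p \<in> W" "S \<in> \<XX>" "\<And>q. q \<in> W \<Longrightarrow> solves X Y q (S q)"
proof -
  obtain W0 x E where W0: "open W0" "p \<in> W0" and F: "frame_on W0 x E"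
    by (rule local_frame)
  note x = frame_onD(1)[OF F] and E = frame_onD(2)[OF F]
  define h where "h = (\<lambda>q v w. g q v w + \<tau> q v * \<tau> q w)"
  have h_linear: "linear_form_on (\<TT> q) (h q v)" if "v \<in> \<TT> q" for q v
    using that by (simp add: h_def linear_form_on_def g_right tau_add tau_scale algebra_simps)
  have h_sym: "h q v w = h q w v" if "v \<in> \<TT> q" "w \<in> \<TT> q" for q v w
    using g_sym[OF that] by (simp add: h_def)
  have h_smooth: "(\<lambda>q. h q (V q) (Z q)) \<in> \<CC>" if "V \<in> \<XX>" "Z \<in> \<XX>" for V Z
    unfolding h_def by (intro smooth_add smooth_mult g_smooth tau_smooth that)
  have h_frame: "h q u w = (\<Sum>b\<in>Basis. w (x b) * h q (E b q) u)"
    if "q \<in> W0" "u \<in> \<TT> q" "w \<in> \<TT> q" for q u w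
  proof -
    have "h q u w = h q u (\<Sum>b\<in>Basis. w (x b) *\<^sub>R E b q)"
      using frame_onD(4)[OF F that(1,3)] by simp
    also have "\<dots> = (\<Sum>b\<in>Basis. w (x b) * h q u (E b q))"
      by (rule linear_form_on_sum[OF h_linear tangent_subspace]) (auto simp: that field_tangent E)
    finally show ?thesis using h_sym[OF that(2) field_tangent[OF E]] by simp
  qed
  have h_nondegenerate: "u = 0" if u: "u \<in> \<TT> q" and 0: "\<And>w. w \<in> \<TT> q \<Longrightarrow> h q u w = 0" for q u
  proof (rule nondegenerate[OF u])
    show "\<tau> q u = 0"
      using 0[OF field_tangent[OF xi_field]] by (simp add: h_def tau_xi g_xi(2)[OF u])
    then show "g q u w = 0" if "w \<in> \<TT> q" for w
      using 0[OF that] by (simp add: h_def)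
  qed
  define \<beta> where "\<beta> = (\<lambda>b q. koszul X Y (E b) q + X q (\<lambda>q. \<tau> q (Y q)) * \<tau> q (E b q))"
  obtain W1 a where W1: "open W1" "p \<in> W1" and a: "\<And>c. a c \<in> \<CC>"
    and sol: "\<And>q b. q \<in> W1 \<Longrightarrow> b \<in> Basis \<Longrightarrow> (\<Sum>c\<in>Basis. h q (E b q) (E c q) * a c q) = \<beta> b q"
  proof (rule smooth_linear_system[of "\<lambda>b c q. h q (E b q) (E c q)" \<beta> p])
    show "(\<lambda>q. h q (E b q) (E c q)) \<in> \<CC>" for b c by (rule h_smooth[OF E E])
    show "\<beta> b \<in> \<CC>" for b
      unfolding \<beta>_def
      by (rule smooth_add[OF koszul_smooth[OF X Y E] smooth_mult[OF field_smooth[OF X tau_smooth[OF Y]] tau_smooth[OF E]]])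
    fix a :: "'e \<Rightarrow> real"
    assume 0: "\<And>b. b \<in> Basis \<Longrightarrow> (\<Sum>c\<in>Basis. h p (E b p) (E c p) * a c) = 0"
    define v where "v = (\<Sum>c\<in>Basis. a c *\<^sub>R E c p)"
    have v: "v \<in> \<TT> p"
      unfolding v_def by (intro subspace_sum subspace_scale tangent_subspace field_tangent E)
    have hv: "h p (E b p) v = 0" if "b \<in> Basis" for b
      unfolding v_def
      using linear_form_on_sum[OF h_linear tangent_subspace, of "E b p" p Basis "\<lambda>c. E c p" a] 0[OF that]
      by (simp add: field_tangent E mult.commute)
    have "v = 0"
      by (rule h_nondegenerate[OF v]) (simp add: h_frame[OF W0(2) v] hv)
    show "\<forall>c\<in>Basis. a c = 0"
    proof
      fix c :: 'e assume c: "c \<in> Basis"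
      have "v (x c) = (\<Sum>b\<in>Basis. a b * E b p (x c))"
        by (simp add: v_def sum_tangent_apply scaleR_fun_def)
      also have "\<dots> = (\<Sum>b\<in>Basis. if b = c then a b else 0)"
        by (rule sum.cong) (simp_all add: frame_onD(3)[OF F W0(2) _ c])
      also have "\<dots> = a c" using c by simp
      finally show "a c = 0" using \<open>v = 0\<close> by simp
    qed
  qed blast
  define S where "S = (\<Sum>c\<in>Basis. fun_scale (a c) (E c))"
  have S: "S \<in> \<XX>"
    unfolding S_def by (intro field_sum field_fun_scale a E)
  have "solves X Y q (S q)" if q: "q \<in> W0 \<inter> W1" for q
  proof -
    have hE: "h q (E b q) (S q) = \<beta> b q" if "b \<in> Basis" for b
      using linear_form_on_sum[OF h_linear tangent_subspace, of "E b q" q Basis "\<lambda>c. E c q" "\<lambda>c. a c q"] sol[of q b] q that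
      by (simp add: S_def sum_field_apply fun_scale_apply field_tangent E mult.commute)
    have hS: "h q (S q) (Z q) = koszul X Y Z q + X q (\<lambda>q. \<tau> q (Y q)) * \<tau> q (Z q)" if Z: "Z \<in> \<XX>" for Z
    proof -
      have "\<tau> q (Z q) = \<tau> q (\<Sum>b\<in>Basis. Z q (x b) *\<^sub>R E b q)"
        using frame_onD(4)[OF F _ field_tangent[OF Z]] q by simp
      also have "\<dots> = (\<Sum>b\<in>Basis. Z q (x b) * \<tau> q (E b q))"
        by (rule linear_form_on_sum[OF tau_linear tangent_subspace]) (simp add: field_tangent E)
      finally have \<tau>Z: "\<tau> q (Z q) = (\<Sum>b\<in>Basis. Z q (x b) * \<tau> q (E b q))" .
      have "h q (S q) (Z q) = (\<Sum>b\<in>Basis. Z q (x b) * h q (E b q) (S q))"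
        using q by (intro h_frame field_tangent S Z) simp
      also have "\<dots> = (\<Sum>b\<in>Basis. Z q (x b) * \<beta> b q)"
        by (simp add: hE)
      also have "\<dots> = koszul X Y Z q + X q (\<lambda>q. \<tau> q (Y q)) * \<tau> q (Z q)"
        using koszul_frame[OF F W0(1) _ X Y Z, of q] q
        by (simp add: \<beta>_def \<tau>Z sum.distrib sum_distrib_left algebra_simps)
      finally show ?thesis .
    qed
    have \<tau>S: "\<tau> q (S q) = X q (\<lambda>q. \<tau> q (Y q))"
      using hS[OF xi_field] by (simp add: h_def tau_xi g_xi(2) field_tangent S koszul_xi X Y)
    then have "g q (S q) (Z q) = koszul X Y Z q" if "Z \<in> \<XX>" for Z
      using hS[OF that] by (simp add: h_def)
    then show ?thesis using \<tau>S by (simp add: solves_def field_tangent S)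
  qed
  with W0 W1 S show thesis by (intro that[of "W0 \<inter> W1" S]) auto
qed

text \<open>Extensional in both arguments, as equality of connections is equality of maps on smooth
  fields.\<close>

definition nabla :: "'a connection"
  where "nabla = (\<lambda>X\<in>\<XX>. \<lambda>Y\<in>\<XX>. \<lambda>p. THE u. solves X Y p u)"

lemma nabla_eqI:
  assumes "X \<in> \<XX>" "Y \<in> \<XX>" "solves X Y p u"
  shows "nabla X Y p = u"
  using assms solves_unique by (auto simp: nabla_def)

lemma nabla_solves:
  assumes "X \<in> \<XX>" "Y \<in> \<XX>"
  shows "solves X Y p (nabla X Y p)"
proof -
  obtain u where u: "solves X Y p u"
    by (rule local_solution[OF assms, of p]) blast
  then show ?thesis using nabla_eqI[OF assms u] by simp
qed

lemma nabla_tangent: "X \<in> \<XX> \<Longrightarrow> Y \<in> \<XX> \<Longrightarrow> nabla X Y p \<in> \<TT> p"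
  and tau_nabla: "X \<in> \<XX> \<Longrightarrow> Y \<in> \<XX> \<Longrightarrow> \<tau> p (nabla X Y p) = X p (\<lambda>q. \<tau> q (Y q))"
  and g_nabla: "X \<in> \<XX> \<Longrightarrow> Y \<in> \<XX> \<Longrightarrow> Z \<in> \<XX> \<Longrightarrow> g p (nabla X Y p) (Z p) = koszul X Y Z p"
  using nabla_solves unfolding solves_def by blast+

lemma nabla_field:
  assumes "X \<in> \<XX>" "Y \<in> \<XX>"
  shows "nabla X Y \<in> \<XX>"
proof (rule fieldI)
  show "nabla X Y p \<in> \<TT> p" for p by (rule nabla_tangent[OF assms])
  fix f assume f: "f \<in> \<CC>"
  show "(\<lambda>p. nabla X Y p f) \<in> \<CC>"
  proof (rule smooth_functions_local)
    fix p
    obtain W S where W: "open W" "p \<in> W" and S: "S \<in> \<XX>" "\<And>q. q \<in> W \<Longrightarrow> solves X Y q (S q)"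
      by (rule local_solution[OF assms, of p]) blast
    have "\<forall>q\<in>W. nabla X Y q f = S q f" using nabla_eqI[OF assms S(2)] by simp
    then show "\<exists>W h. open W \<and> p \<in> W \<and> h \<in> \<CC> \<and> (\<forall>q\<in>W. nabla X Y q f = h q)"
      using W field_smooth[OF S(1) f] by blast
  qed
qed

text \<open>Every identity between fields \<open>nabla X Y\<close> is proved by checking that the asserted value solves the
  defining conditions, which have only one solution.\<close>

lemma nabla_connection: "linear_connection A nabla"
proof -
  note T = nabla_tangent field_tangent subspace_add[OF tangent_subspace] subspace_scale[OF tangent_subspace]
  have "nabla \<in> \<XX> \<rightarrow>\<^sub>E (\<XX> \<rightarrow>\<^sub>E \<XX>)"
  proof (intro PiE_I)
    show "nabla X Y \<in> \<XX>" if "X \<in> \<XX>" "Y \<in> \<XX>" for X Y by (rule nabla_field[OF that])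
  qed (simp_all add: nabla_def)
  moreover have "nabla (X + X') Y = nabla X Y + nabla X' Y" if "X \<in> \<XX>" "X' \<in> \<XX>" "Y \<in> \<XX>" for X X' Y
  proof
    show "nabla (X + X') Y p = (nabla X Y + nabla X' Y) p" for p
      by (rule nabla_eqI) (simp_all add: that field_add solves_def T g_left tau_add tau_nabla g_nabla koszul_add_1)
  qed
  moreover have "nabla (fun_scale f X) Y = fun_scale f (nabla X Y)"
    if "f \<in> \<CC>" "X \<in> \<XX>" "Y \<in> \<XX>" for f X Y
  proof
    have s: "fun_scale f X p h = f p * X p h" for p h by (simp add: fun_scale_apply scaleR_fun_def)
    show "nabla (fun_scale f X) Y p = fun_scale f (nabla X Y) p" for p
      by (rule nabla_eqI)
        (simp_all add: that field_fun_scale solves_def fun_scale_apply[of f "nabla X Y"] s T g_left tau_scale tau_nabla g_nabla koszul_scale_1)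
  qed
  moreover have "nabla X (Y + Y') = nabla X Y + nabla X Y'" if "X \<in> \<XX>" "Y \<in> \<XX>" "Y' \<in> \<XX>" for X Y Y'
  proof
    show "nabla X (Y + Y') p = (nabla X Y + nabla X Y') p" for p
      by (rule nabla_eqI) (simp_all add: that field_add solves_def T g_left tau_add tau_nabla g_nabla koszul_add_2
          tangent_add[OF field_tangent[OF that(1)]] tau_smooth)
  qed
  moreover have leibniz: "nabla X (fun_scale f Y) = fun_scale (\<lambda>p. X p f) Y + fun_scale f (nabla X Y)"
    if "f \<in> \<CC>" "X \<in> \<XX>" "Y \<in> \<XX>" for f X Y
  proof
    show "nabla X (fun_scale f Y) p = (fun_scale (\<lambda>p. X p f) Y + fun_scale f (nabla X Y)) p" for p
      by (rule nabla_eqI)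
        (simp_all add: that field_fun_scale solves_def fun_scale_apply T g_left tau_add tau_scale tau_nabla g_nabla
          koszul_scale_2 tangent_mult[OF field_tangent[OF that(2)]] tau_smooth algebra_simps)
  qed
  moreover have "nabla X (c *\<^sub>R Y) = c *\<^sub>R nabla X Y" if "X \<in> \<XX>" "Y \<in> \<XX>" for c X Y
  proof -
    have "fun_scale (\<lambda>p. X p (\<lambda>q. c)) Y = 0"
      by (simp add: fun_scale_def fun_eq_iff tangent_const[OF field_tangent[OF that(1)]])
    then show ?thesis
      using leibniz[OF smooth_const that] by (simp add: scaleR_eq_fun_scale)
  qed
  ultimately show ?thesis
    unfolding linear_connection_def by (intro conjI ballI allI)
qed

text \<open>Both conditions on \<open>\<nabla>\<^sub>Y X + [X, Y]\<close> hold: the one for \<open>g\<close> is the antisymmetric part of the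
  Koszul expression, the one for \<open>\<tau>\<close> is \<open>d \<tau> = 0\<close>.\<close>

lemma nabla_torsion_free: "torsion_free A nabla"
  unfolding torsion_free_def
proof (intro ballI)
  fix X Y assume X: "X \<in> \<XX>" and Y: "Y \<in> \<XX>"
  have "nabla X Y p = nabla Y X p + lie_bracket X Y p" for p
  proof (rule nabla_eqI[OF X Y])
    have "g p (nabla Y X p + lie_bracket X Y p) (Z p) = koszul X Y Z p" if "Z \<in> \<XX>" for Z
      using koszul_swap_12[OF X Y that, of p] that
      by (simp add: g_left nabla_tangent field_tangent field_bracket X Y g_nabla)
    then show "solves X Y p (nabla Y X p + lie_bracket X Y p)"
      by (simp add: solves_def X Y nabla_tangent field_tangent field_bracket subspace_add[OF tangent_subspace]
          tau_add tau_nabla tau_bracket)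
  qed
  then show "nabla X Y - nabla Y X - lie_bracket X Y = 0" by (simp add: fun_eq_iff)
qed

lemma nabla_metric:
  assumes "X \<in> \<XX>" "Y \<in> \<XX>" "Z \<in> \<XX>"
  shows "cov_deriv_metric nabla g X Y Z p = 0"
  using koszul_swap_23[OF assms, of p] g_sym[of "Y p" p "nabla X Z p"] assms
  by (simp add: cov_deriv_metric_def g_nabla field_tangent nabla_tangent)

lemma nabla_form: "X \<in> \<XX> \<Longrightarrow> Y \<in> \<XX> \<Longrightarrow> cov_deriv_form nabla \<tau> X Y p = 0"
  by (simp add: cov_deriv_form_def tau_nabla)

text \<open>The classical derivation of the Koszul formula uses only torsion-freeness and compatibility with
  \<open>g\<close>, so it survives the degeneracy of \<open>g\<close>; the component along \<open>\<xi>\<close> is fixed by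
  \<open>\<tau> (D\<^sub>X Y) = X (\<tau> Y)\<close>.\<close>

lemma nabla_unique:
  assumes D: "linear_connection A D" "torsion_free A D"
    and metric: "\<And>X Y Z p. X \<in> \<XX> \<Longrightarrow> Y \<in> \<XX> \<Longrightarrow> Z \<in> \<XX> \<Longrightarrow> cov_deriv_metric D g X Y Z p = 0"
    and form: "\<And>X Y p. X \<in> \<XX> \<Longrightarrow> Y \<in> \<XX> \<Longrightarrow> cov_deriv_form D \<tau> X Y p = 0"
  shows "D = nabla"
proof -
  have E: "D \<in> \<XX> \<rightarrow>\<^sub>E (\<XX> \<rightarrow>\<^sub>E \<XX>)" using D(1) by (simp add: linear_connection_def)
  have DF: "D X Y \<in> \<XX>" if "X \<in> \<XX>" "Y \<in> \<XX>" for X Y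
    using E that by blast
  have gD: "X p (\<lambda>q. g q (Y q) (Z q)) = g p (D X Y p) (Z p) + g p (D X Z p) (Y p)"
    if "X \<in> \<XX>" "Y \<in> \<XX>" "Z \<in> \<XX>" for X Y Z p
    using metric[OF that, of p] g_sym[of "Y p" p "D X Z p"] that
    by (simp add: cov_deriv_metric_def field_tangent DF)
  have bD: "g p (lie_bracket X Y p) (Z p) = g p (D X Y p) (Z p) - g p (D Y X p) (Z p)"
    if "X \<in> \<XX>" "Y \<in> \<XX>" "Z \<in> \<XX>" for X Y Z p
  proof -
    have "D X Y - D Y X - lie_bracket X Y = 0" using D(2) that by (simp add: torsion_free_def)
    then have "D X Y p = D Y X p + lie_bracket X Y p" by (simp add: fun_eq_iff diff_eq_eq add.commute)
    then show ?thesis using that by (simp add: g_left field_tangent DF field_bracket)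
  qed
  have "nabla X Y = D X Y" if X: "X \<in> \<XX>" and Y: "Y \<in> \<XX>" for X Y
  proof
    fix p
    have "g p (D X Y p) (Z p) = koszul X Y Z p" if Z: "Z \<in> \<XX>" for Z
      by (simp add: koszul_def gD bD X Y Z)
    moreover have "\<tau> p (D X Y p) = X p (\<lambda>q. \<tau> q (Y q))"
      using form[OF X Y] by (simp add: cov_deriv_form_def)
    ultimately show "nabla X Y p = D X Y p"
      by (intro nabla_eqI X Y) (simp add: solves_def field_tangent DF X Y)
  qed
  moreover have "nabla \<in> \<XX> \<rightarrow>\<^sub>E (\<XX> \<rightarrow>\<^sub>E \<XX>)"
    using nabla_connection by (simp add: linear_connection_def)
  ultimately show ?thesis
    using E by (intro PiE_ext[OF E]) (auto intro!: PiE_ext[of _ \<XX> "\<lambda>_. \<XX>"] )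
qed

end

theorem corollary1p2:
  fixes A :: "('a::{t2_space,second_countable_topology}, 'e::euclidean_space) chart set"
    and g :: "'a bilinear_field"
    and \<xi> :: "'a field"
    and \<tau> :: "'a form"
  assumes "smooth_atlas A"
    and "light_like_metric A 1 g"
    and "trivial_line_bundle A (radical_space A g)"
    and "\<xi> \<in> smooth_sections A (radical_space A g)"
    and "\<forall>p. \<xi> p \<noteq> 0"
    and "\<forall>Y\<in>vector_fields A. \<forall>Z\<in>vector_fields A. \<forall>p. lie_derivative \<xi> g Y Z p = 0"
    and "closed_one_form A \<tau>"
    and "\<forall>p. \<tau> p (\<xi> p) = 1"
  shows "\<exists>!D. linear_connection A D \<and> torsion_free A D \<and>
    (\<forall>X\<in>vector_fields A.
      (\<forall>Y\<in>vector_fields A. \<forall>Z\<in>vector_fields A. \<forall>p. cov_deriv_metric D g X Y Z p = 0) \<and>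
      (\<forall>Y\<in>vector_fields A. \<forall>p. cov_deriv_form D \<tau> X Y p = 0))"
proof -
  interpret lightlike_data A g \<xi> \<tau>
    by unfold_locales (use assms in \<open>simp_all add: light_like_metric_def\<close>)
  show ?thesis
  proof (rule ex1I[of _ nabla])
    show "linear_connection A nabla \<and> torsion_free A nabla \<and>
      (\<forall>X\<in>\<XX>. (\<forall>Y\<in>\<XX>. \<forall>Z\<in>\<XX>. \<forall>p. cov_deriv_metric nabla g X Y Z p = 0) \<and>
        (\<forall>Y\<in>\<XX>. \<forall>p. cov_deriv_form nabla \<tau> X Y p = 0))"
      using nabla_connection nabla_torsion_free nabla_metric nabla_form by simp
  qed (use nabla_unique in blast)
qed

end
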